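(* Let $f\in\mathcal{E}$ and define the entire function $\vartheta(x)=\sum_{n=0}^\infty\left(\sum_{j=1}^{n+1}f(j)\right)\frac{x^n}{n!}$. Then for $z\in\mathbb{C}$ with $\Re(z)>0$, $$\sum_z f=\frac{1}{\Gamma(1-z)}\left(\sum_{n=0}^\infty\Big(\sum_{j=1}^{n+1}f(j)\Big)\frac{(-1)^n}{n!\,(n+1-z)}+\int_1^\infty\vartheta(-x)x^{-z}\,dx\right),$$ where at positive integers $z$ the right-hand side is understood as its limiting value.
   Context: The space $\mathcal{E}$ consists of all functions $f$ holomorphic on $\{z\in\mathbb{C}:\Re(z)>0\}$ such that for every $y\in\mathbb{R}$ the limit of $f(z)$ as $\Re(z)\to0^+$ along $\Im(z)=y$ exists and is finite, and such that there exist real $\alpha,\rho,C$ with $0\le\alpha<\pi/2$, $\rho\geq 0$, $C>0$ and $|f(z)|<Ce^{\alpha|\Im(z)|+\rho|\Re(z)|}$ for $\Re(z)>0$. For $f\in\mathcal{E}$ and $\Re(z)>0$, the indefinite sum $\sum_z f$ (a subscript $z$ with no limits) is defined, for any $\sigma>0$, by $$\sum_z f=\frac{1}{\Gamma(z)}\int_0^\infty t^{z-1}e^{-t}\int_0^t\frac{e^x}{2\pi i}\int_{\sigma-i\infty}^{\sigma+i\infty}\Gamma(\xi)f(\xi)x^{-\xi}\,d\xi\,dx\,dt .$$ Sums with explicit limits, such as $\sum_{j=1}^{n+1}$ and $\sum_{n=0}^\infty$, are ordinary sums. $\Gamma$ is Euler's Gamma function. *)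

theory Defs
  imports "HOL-Complex_Analysis.Complex_Analysis"
begin

definition space_E :: "(complex \<Rightarrow> complex) set" where
  "space_E = {f. f holomorphic_on {z. Re z > 0} \<and>
     (\<forall>y::real. \<exists>l. ((\<lambda>x. f (Complex x y)) \<longlongrightarrow> l) (at_right 0)) \<and>
     (\<exists>\<alpha> \<rho> C :: real. 0 \<le> \<alpha> \<and> \<alpha> < pi / 2 \<and> 0 \<le> \<rho> \<and> 0 < C \<and>
        (\<forall>z. Re z > 0 \<longrightarrow> norm (f z) < C * exp (\<alpha> * \<bar>Im z\<bar> + \<rho> * \<bar>Re z\<bar>)))}"

text \<open>
  All integrals below are Lebesgue integrals. The contour integral from \<open>\<sigma> - \<i>\<infinity>\<close> to
  \<open>\<sigma> + \<i>\<infinity>\<close> is written in the parametrisation \<open>\<xi> = \<sigma> + \<i> y\<close>, \<open>d\<xi> = \<i> dy\<close>.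
\<close>

definition vertical_integrable :: "real \<Rightarrow> (complex \<Rightarrow> complex) \<Rightarrow> bool" where
  "vertical_integrable \<sigma> g \<longleftrightarrow> integrable lborel (\<lambda>y::real. g (Complex \<sigma> y))"

definition vertical_integral :: "real \<Rightarrow> (complex \<Rightarrow> complex) \<Rightarrow> complex" where
  "vertical_integral \<sigma> g = \<i> * (LINT y|lborel. g (Complex \<sigma> y))"

definition indef_sum_kernel :: "(complex \<Rightarrow> complex) \<Rightarrow> real \<Rightarrow> complex \<Rightarrow> complex" where
  "indef_sum_kernel f x \<xi> = Gamma \<xi> * f \<xi> * of_real x powr (- \<xi>)"

definition indef_sum_inner :: "real \<Rightarrow> (complex \<Rightarrow> complex) \<Rightarrow> real \<Rightarrow> complex" where
  "indef_sum_inner \<sigma> f x =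
     of_real (exp x) / (2 * of_real pi * \<i>) * vertical_integral \<sigma> (indef_sum_kernel f x)"

definition indef_sum_outer :: "real \<Rightarrow> (complex \<Rightarrow> complex) \<Rightarrow> complex \<Rightarrow> real \<Rightarrow> complex" where
  "indef_sum_outer \<sigma> f z t =
     of_real t powr (z - 1) * of_real (exp (- t)) *
       (LINT x:{0<..<t}|lborel. indef_sum_inner \<sigma> f x)"

definition indef_sum :: "real \<Rightarrow> (complex \<Rightarrow> complex) \<Rightarrow> complex \<Rightarrow> complex" where
  "indef_sum \<sigma> f z = 1 / Gamma z * (LINT t:{0<..}|lborel. indef_sum_outer \<sigma> f z t)"

definition indef_sum_converges :: "real \<Rightarrow> (complex \<Rightarrow> complex) \<Rightarrow> complex \<Rightarrow> bool" where
  "indef_sum_converges \<sigma> f z \<longleftrightarrow>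
     (\<forall>x>0. vertical_integrable \<sigma> (indef_sum_kernel f x)) \<and>
     (\<forall>t>0. set_integrable lborel {0<..<t} (indef_sum_inner \<sigma> f)) \<and>
     set_integrable lborel {0<..} (indef_sum_outer \<sigma> f z)"

definition vartheta_term :: "(complex \<Rightarrow> complex) \<Rightarrow> complex \<Rightarrow> nat \<Rightarrow> complex" where
  "vartheta_term f x n = (\<Sum>j=1..n+1. f (of_nat j)) * (x ^ n / fact n)"

definition vartheta :: "(complex \<Rightarrow> complex) \<Rightarrow> complex \<Rightarrow> complex" where
  "vartheta f x = (\<Sum>n. vartheta_term f x n)"

definition rhs_term :: "(complex \<Rightarrow> complex) \<Rightarrow> complex \<Rightarrow> nat \<Rightarrow> complex" where
  "rhs_term f z n =
     (\<Sum>j=1..n+1. f (of_nat j)) * ((-1) ^ n / (fact n * (of_nat n + 1 - z)))"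

definition rhs_integrand :: "(complex \<Rightarrow> complex) \<Rightarrow> complex \<Rightarrow> real \<Rightarrow> complex" where
  "rhs_integrand f z x = vartheta f (- of_real x) * of_real x powr (- z)"

text \<open>
  The next expression has its intended meaning for \<open>z\<close> not a positive integer; at a
  positive integer only its limit is meaningful.
\<close>

definition rhs :: "(complex \<Rightarrow> complex) \<Rightarrow> complex \<Rightarrow> complex" where
  "rhs f z = 1 / Gamma (1 - z) *
     ((\<Sum>n. rhs_term f z n) + (LINT x:{1..}|lborel. rhs_integrand f z x))"

end

theory Submission
  imports Defs
begin

text \<open>
  Shifting the line of integration interpolates the partial sums of \<open>f\<close>: for \<open>0 < c\<close>, \<open>c\<close> not an
  integer and \<open>c - 1 < Re z < c\<close>, the function
  \<open>F z = (\<Sum>j<c. f j) + 1/(2\<i>) \<integral>\<^bsub>Re \<xi> = c\<^esub> f \<xi> (cot (\<pi> (\<xi> - z)) - cot (\<pi> \<xi>)) d\<xi>\<close>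
  does not depend on \<open>c\<close>, is holomorphic for \<open>Re z > -1\<close>, satisfies \<open>F n = f 1 + \<dots> + f n\<close> and
  \<open>F z - F (z - 1) = f z\<close>, and grows at most like \<open>exp (\<alpha> \<bar>Im z\<bar> + \<kappa> Re z)\<close> with \<open>\<alpha> < \<pi>/2\<close>.
  Both sides of the corollary equal \<open>F z\<close>.

  Let \<open>v\<close> be the inverse Mellin transform of \<open>Gamma s F s\<close>. Since \<open>F 0 = 0\<close>, it may be taken along a
  line with \<open>-1/2 < Re s < 0\<close>, so that \<open>v x\<close> vanishes as \<open>x\<close> tends to \<open>0\<close>. The difference equation
  says that the inverse Mellin transform of \<open>Gamma s f s\<close> is \<open>v + v'\<close>; hence the inner integral
  of the indefinite sum is \<open>\<integral>\<^bsub>0\<^esub>\<^bsup>t\<^esup> (exp x v x)' dx = exp t v t\<close>, and Mellin inversion turns the outer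
  integral into \<open>Gamma z F z\<close>.

  On the other side, \<open>\<vartheta> (-x)\<close> is the sum of the residues of \<open>Gamma s F (1 - s) x\<^bsup>-s\<^esup>\<close> at the poles of
  \<open>Gamma\<close>, that is, an inverse Mellin transform. The integral over \<open>x \<ge> 1\<close> becomes an integral of
  \<open>Gamma s F (1 - s) / (s + z - 1)\<close> over a vertical line, and closing that line to the left yields minus
  the series together with the residue \<open>Gamma (1 - z) F z\<close> at \<open>s = 1 - z\<close>.
\<close>

lemma set_integrable_lborel_nonneg:
  fixes f :: "real \<Rightarrow> real"
  assumes "f integrable_on S" "\<And>x. x \<in> S \<Longrightarrow> 0 \<le> f x"
    and [measurable]: "S \<in> sets borel" "f \<in> borel_measurable borel"
  shows "set_integrable lborel S f"
proof -
  have "f absolutely_integrable_on S"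
    using assms by (intro nonnegative_absolutely_integrable_1) auto
  then show ?thesis
    unfolding set_integrable_def by (subst (asm) integrable_completion) auto
qed

lemma integrable_exp_minus_abs:
  fixes d :: real
  assumes "d > 0"
  shows "integrable lborel (\<lambda>y::real. exp (- d * \<bar>y\<bar>))"
proof -
  define h where "h y = indicator {0..} y *\<^sub>R exp (- d * y)" for y :: real
  have right: "integrable lborel h"
    using set_integrable_lborel_nonneg[OF integrable_on_exp_minus_to_infinity[OF assms, of 0]]
    by (simp add: h_def[abs_def] set_integrable_def)
  have left: "integrable lborel (\<lambda>y. h (0 + (-1) * y))"
    by (rule lborel_integrable_real_affine[OF right]) simp
  show ?thesis
    using Bochner_Integration.integrable_add[OF right left]
    by (rule Bochner_Integration.integrable_bound) (auto simp: h_def indicator_def)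
qed

lemma integrable_exp_decay:
  fixes h :: "real \<Rightarrow> 'a :: {banach, second_countable_topology}"
  assumes cont: "continuous_on UNIV h" and "d > 0"
    and decay: "\<And>y. Y \<le> \<bar>y\<bar> \<Longrightarrow> norm (h y) \<le> M * exp (- d * \<bar>y\<bar>)"
  shows "integrable lborel h"
proof -
  have [measurable]: "h \<in> borel_measurable borel"
    using cont by (rule borel_measurable_continuous_onI)
  have "set_integrable lborel {-Y..Y} h"
    unfolding set_integrable_def
    by (intro borel_integrable_compact continuous_on_subset[OF cont]) auto
  moreover have "set_integrable lborel (- {-Y..Y}) h"
  proof (rule set_integrable_bound)
    have "integrable lborel (\<lambda>y. M * exp (- d * \<bar>y\<bar>))"
      by (intro integrable_mult_right integrable_exp_minus_abs \<open>d > 0\<close>)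
    then show "set_integrable lborel (- {-Y..Y}) (\<lambda>y. M * exp (- d * \<bar>y\<bar>))"
      unfolding set_integrable_def by (rule integrable_mult_indicator[rotated]) auto
    show "AE y in lborel. y \<in> - {-Y..Y} \<longrightarrow> norm (h y) \<le> norm (M * exp (- d * \<bar>y\<bar>))"
      using decay by (intro AE_I2 impI) (auto intro!: order_trans[OF decay])
  qed (simp add: set_borel_measurable_def)
  ultimately have "set_integrable lborel ({-Y..Y} \<union> - {-Y..Y}) h"
    by (intro set_integrable_Un) auto
  then show ?thesis by (simp add: set_integrable_def)
qed

section \<open>Vertical line integrals\<close>

lemma vertical_integral_cong:
  "(\<And>s. Re s = c \<Longrightarrow> f s = g s) \<Longrightarrow> vertical_integral c f = vertical_integral c g"
  by (simp add: vertical_integral_def)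

lemma vertical_integral_mult_right: "vertical_integral c (\<lambda>s. k * f s) = k * vertical_integral c f"
  by (simp add: vertical_integral_def)

lemma vertical_integral_minus: "vertical_integral c (\<lambda>s. - f s) = - vertical_integral c f"
  by (simp add: vertical_integral_def)

lemma vertical_integral_diff:
  "vertical_integrable c f \<Longrightarrow> vertical_integrable c g \<Longrightarrow>
     vertical_integral c (\<lambda>s. f s - g s) = vertical_integral c f - vertical_integral c g"
  by (simp add: vertical_integral_def vertical_integrable_def right_diff_distrib)

lemma continuous_on_vertical_line:
  assumes "continuous_on S G" "{s. Re s = c} \<subseteq> S"
  shows "continuous_on UNIV (\<lambda>y. G (Complex c y))"
proof (rule continuous_on_compose2[OF assms(1)])
  show "continuous_on UNIV (Complex c)"
    unfolding Complex_eq by (intro continuous_intros)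
qed (use assms(2) in auto)

lemma vertical_segments_tendsto_vertical_integral:
  assumes "vertical_integrable c G"
  shows "(\<lambda>n. contour_integral (linepath (Complex c (- real n)) (Complex c (real n))) G) \<longlonglongrightarrow>
      vertical_integral c G"
proof -
  let ?h = "\<lambda>y. G (Complex c y)"
  have exhaust: "(\<Union>n. {- real n..real n}) = UNIV"
  proof (intro equalityI subsetI UN_I[OF UNIV_I])
    show "y \<in> {- real (nat \<lceil>\<bar>y\<bar>\<rceil>)..real (nat \<lceil>\<bar>y\<bar>\<rceil>)}" for y
      using real_nat_ceiling_ge[of "\<bar>y\<bar>"] unfolding atLeastAtMost_iff by linarith
  qed auto
  have int: "set_integrable lborel A ?h" if "A \<in> sets lborel" for A
    using that assms unfolding set_integrable_def vertical_integrable_def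
    by (rule integrable_mult_indicator)
  have "(\<lambda>n. LINT y:{- real n..real n}|lborel. ?h y) \<longlonglongrightarrow>
      (LINT y:(\<Union>n. {- real n..real n})|lborel. ?h y)"
    by (intro set_integral_cont_up int) (auto simp: incseq_def)
  then have "(\<lambda>n. \<i> * (LINT y:{- real n..real n}|lborel. ?h y)) \<longlonglongrightarrow> vertical_integral c G"
    unfolding exhaust vertical_integral_def
    by (intro tendsto_mult_left) (simp add: set_lebesgue_integral_def)
  then show ?thesis
  proof (rule Lim_transform_eventually)
    show "\<forall>\<^sub>F n in sequentially. \<i> * (LINT y:{- real n..real n}|lborel. ?h y) =
        contour_integral (linepath (Complex c (- real n)) (Complex c (real n))) G"
      using eventually_gt_at_top[of 0]
    proof eventually_elim
      case (elim n)
      then show ?case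
        using contour_integral_linepath_same_Re[of "Complex c (- real n)" c "Complex c (real n)"
            "- real n" "real n" G]
          set_borel_integral_eq_integral(2)[OF int[of "{- real n..real n}"]] by simp
    qed
  qed
qed

definition strip_growth :: "real \<Rightarrow> real \<Rightarrow> real \<Rightarrow> (complex \<Rightarrow> complex) \<Rightarrow> bool" where
  "strip_growth a b \<beta> G \<longleftrightarrow>
     (\<exists>Y M. \<forall>s. a \<le> Re s \<and> Re s \<le> b \<and> Y \<le> \<bar>Im s\<bar> \<longrightarrow> norm (G s) \<le> M * exp (\<beta> * \<bar>Im s\<bar>))"

lemma strip_growthI:
  assumes "\<And>s. a \<le> Re s \<Longrightarrow> Re s \<le> b \<Longrightarrow> Y \<le> \<bar>Im s\<bar> \<Longrightarrow> norm (G s) \<le> M * exp (\<beta> * \<bar>Im s\<bar>)"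
  shows "strip_growth a b \<beta> G"
  using assms unfolding strip_growth_def by blast

lemma strip_growthE:
  assumes "strip_growth a b \<beta> G"
  obtains Y M where "Y \<ge> 0" "M \<ge> 0"
    "\<And>s. a \<le> Re s \<Longrightarrow> Re s \<le> b \<Longrightarrow> Y \<le> \<bar>Im s\<bar> \<Longrightarrow> norm (G s) \<le> M * exp (\<beta> * \<bar>Im s\<bar>)"
proof -
  obtain Y M where bound: "\<And>s. a \<le> Re s \<Longrightarrow> Re s \<le> b \<Longrightarrow> Y \<le> \<bar>Im s\<bar> \<Longrightarrow> norm (G s) \<le> M * exp (\<beta> * \<bar>Im s\<bar>)"
    using assms unfolding strip_growth_def by blast
  have "norm (G s) \<le> \<bar>M\<bar> * exp (\<beta> * \<bar>Im s\<bar>)" if "a \<le> Re s" "Re s \<le> b" "\<bar>Y\<bar> \<le> \<bar>Im s\<bar>" for s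
    by (rule order_trans[OF bound[of s]]) (use that in \<open>auto intro: mult_right_mono\<close>)
  then show ?thesis by (intro that[of "\<bar>Y\<bar>" "\<bar>M\<bar>"]) auto
qed

lemma strip_growth_subset:
  assumes "strip_growth a b \<beta> G" "a \<le> a'" "b' \<le> b"
  shows "strip_growth a' b' \<beta> G"
  using assms unfolding strip_growth_def by (meson order_trans)

lemma strip_growth_mult:
  assumes F: "strip_growth a b \<beta> F" and G: "strip_growth a b \<gamma> G"
  shows "strip_growth a b (\<beta> + \<gamma>) (\<lambda>s. F s * G s)"
proof -
  obtain Y M where Y: "Y \<ge> 0" "M \<ge> 0"
    "\<And>s. a \<le> Re s \<Longrightarrow> Re s \<le> b \<Longrightarrow> Y \<le> \<bar>Im s\<bar> \<Longrightarrow> norm (F s) \<le> M * exp (\<beta> * \<bar>Im s\<bar>)"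
    using F by (elim strip_growthE) blast
  obtain Z N where Z: "Z \<ge> 0" "N \<ge> 0"
    "\<And>s. a \<le> Re s \<Longrightarrow> Re s \<le> b \<Longrightarrow> Z \<le> \<bar>Im s\<bar> \<Longrightarrow> norm (G s) \<le> N * exp (\<gamma> * \<bar>Im s\<bar>)"
    using G by (elim strip_growthE) blast
  show ?thesis
  proof (rule strip_growthI)
    fix s assume "a \<le> Re s" "Re s \<le> b" "max Y Z \<le> \<bar>Im s\<bar>"
    then have "norm (F s * G s) \<le> (M * exp (\<beta> * \<bar>Im s\<bar>)) * (N * exp (\<gamma> * \<bar>Im s\<bar>))"
      unfolding norm_mult using Y Z by (intro mult_mono) auto
    then show "norm (F s * G s) \<le> (M * N) * exp ((\<beta> + \<gamma>) * \<bar>Im s\<bar>)"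
      by (simp add: exp_add algebra_simps)
  qed
qed

lemma strip_growth_cong:
  assumes "strip_growth a b \<beta> F"
    and "\<And>s. a \<le> Re s \<Longrightarrow> Re s \<le> b \<Longrightarrow> Im s \<noteq> 0 \<Longrightarrow> G s = F s"
  shows "strip_growth a b \<beta> G"
proof -
  obtain Y M where "Y \<ge> 0" "M \<ge> 0"
    "\<And>s. a \<le> Re s \<Longrightarrow> Re s \<le> b \<Longrightarrow> Y \<le> \<bar>Im s\<bar> \<Longrightarrow> norm (F s) \<le> M * exp (\<beta> * \<bar>Im s\<bar>)"
    using assms(1) by (elim strip_growthE) blast
  then show ?thesis
    using assms(2) by (intro strip_growthI[where Y = "max Y 1" and M = M]) auto
qed

lemma strip_growth_shift:
  assumes "strip_growth a b \<beta> G"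
  shows "strip_growth (a + t) (b + t) \<beta> (\<lambda>s. G (s - of_real t))"
proof -
  obtain Y M where "Y \<ge> 0" "M \<ge> 0"
    and bound: "\<And>s. a \<le> Re s \<Longrightarrow> Re s \<le> b \<Longrightarrow> Y \<le> \<bar>Im s\<bar> \<Longrightarrow> norm (G s) \<le> M * exp (\<beta> * \<bar>Im s\<bar>)"
    using assms by (elim strip_growthE) blast
  show ?thesis
    by (rule strip_growthI[where Y = Y and M = M]) (use bound[of "_ - of_real t"] in auto)
qed

lemma strip_growth_add_const:
  assumes "\<epsilon> > 0"
  shows "strip_growth a b \<epsilon> (\<lambda>s. s + w)"
proof (rule strip_growthI)
  fix s assume s: "a \<le> Re s" "Re s \<le> b"
  define E where "E = exp (\<epsilon> * \<bar>Im s\<bar>)"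
  have "1 \<le> E" using assms by (simp add: E_def)
  have "norm (s + w) \<le> \<bar>Im s\<bar> + (\<bar>a\<bar> + \<bar>b\<bar> + norm w) * 1"
    using norm_triangle_ineq[of s w] cmod_le[of s] s by simp
  also have "\<dots> \<le> E / \<epsilon> + (\<bar>a\<bar> + \<bar>b\<bar> + norm w) * E"
  proof (intro add_mono mult_left_mono \<open>1 \<le> E\<close>)
    have "\<epsilon> * \<bar>Im s\<bar> \<le> E" using exp_ge_add_one_self[of "\<epsilon> * \<bar>Im s\<bar>"] unfolding E_def by linarith
    then show "\<bar>Im s\<bar> \<le> E / \<epsilon>" using assms by (simp add: field_simps)
  qed auto
  finally show "norm (s + w) \<le> (1 / \<epsilon> + \<bar>a\<bar> + \<bar>b\<bar> + norm w) * exp (\<epsilon> * \<bar>Im s\<bar>)"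
    by (simp add: E_def distrib_right add.assoc)
qed

lemma strip_growth_exp_bound:
  assumes "B \<ge> 0"
    and bound: "\<And>s. a \<le> Re s \<Longrightarrow> Re s \<le> b \<Longrightarrow> Y \<le> \<bar>Im s\<bar> \<Longrightarrow>
      norm (G s) \<le> B * exp (\<beta> * \<bar>Im s\<bar> + \<kappa> * Re s)"
  shows "strip_growth a b \<beta> G"
proof (rule strip_growthI)
  fix s assume s: "a \<le> Re s" "Re s \<le> b" "Y \<le> \<bar>Im s\<bar>"
  have "\<kappa> * Re s \<le> \<bar>\<kappa>\<bar> * \<bar>Re s\<bar>" by (metis abs_ge_self abs_mult)
  also have "\<dots> \<le> \<bar>\<kappa>\<bar> * (\<bar>a\<bar> + \<bar>b\<bar>)" using s by (intro mult_left_mono) auto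
  finally have "B * exp (\<beta> * \<bar>Im s\<bar> + \<kappa> * Re s) \<le> B * exp (\<bar>\<kappa>\<bar> * (\<bar>a\<bar> + \<bar>b\<bar>) + \<beta> * \<bar>Im s\<bar>)"
    using \<open>B \<ge> 0\<close> by (intro mult_left_mono) auto
  then show "norm (G s) \<le> (B * exp (\<bar>\<kappa>\<bar> * (\<bar>a\<bar> + \<bar>b\<bar>))) * exp (\<beta> * \<bar>Im s\<bar>)"
    using bound[OF s] by (simp add: exp_add mult.assoc)
qed

lemma strip_growth_of_real_powr:
  assumes "x > 0"
  shows "strip_growth a b 0 (\<lambda>s. of_real x powr (- s))"
  using assms by (intro strip_growth_exp_bound[where B = 1 and \<kappa> = "- ln x"])
    (auto simp: norm_powr_real_powr powr_def mult.commute)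

lemma strip_growth_inverse_diff: "strip_growth a b 0 (\<lambda>s. 1 / (s - z))"
proof (rule strip_growthI)
  fix s assume "\<bar>Im z\<bar> + 1 \<le> \<bar>Im s\<bar>"
  then have "1 \<le> norm (s - z)" using abs_Im_le_cmod[of "s - z"] by simp
  then show "norm (1 / (s - z)) \<le> 1 * exp (0 * \<bar>Im s\<bar>)"
    by (simp add: norm_divide divide_le_eq_1)
qed

lemma vertical_integrable_strip_growth:
  assumes "strip_growth c c \<beta> G" "\<beta> < 0"
    and "continuous_on S G" "{s. Re s = c} \<subseteq> S"
  shows "vertical_integrable c G"
proof -
  obtain Y M where "Y \<ge> 0" "M \<ge> 0"
    "\<And>s. c \<le> Re s \<Longrightarrow> Re s \<le> c \<Longrightarrow> Y \<le> \<bar>Im s\<bar> \<Longrightarrow> norm (G s) \<le> M * exp (\<beta> * \<bar>Im s\<bar>)"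
    using assms(1) by (elim strip_growthE) blast
  from this(3)[of "Complex c _"] have "norm (G (Complex c y)) \<le> M * exp (- (- \<beta>) * \<bar>y\<bar>)"
    if "Y \<le> \<bar>y\<bar>" for y
    using that by simp
  then show ?thesis
    unfolding vertical_integrable_def using assms(2-4)
    by (intro integrable_exp_decay[of _ "- \<beta>"] continuous_on_vertical_line) auto
qed

lemma norm_vertical_integral_le:
  assumes "vertical_integrable c G" "integrable lborel h" "\<And>y. norm (G (Complex c y)) \<le> h y"
  shows "norm (vertical_integral c G) \<le> (LINT y|lborel. h y)"
  using assms Bochner_Integration.integral_norm_bound_integral[of lborel "\<lambda>y. G (Complex c y)" h]
  by (simp add: vertical_integral_def vertical_integrable_def norm_mult)

section \<open>The residue theorem on vertical strips\<close>

lemma rectpath_edges_subset_path_image: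
  defines "b a c \<equiv> Complex (Re c) (Im a)" and "d a c \<equiv> Complex (Re a) (Im c)"
  shows "closed_segment a (b a c) \<subseteq> path_image (rectpath a c)"
    "closed_segment (b a c) c \<subseteq> path_image (rectpath a c)"
    "closed_segment c (d a c) \<subseteq> path_image (rectpath a c)"
    "closed_segment (d a c) a \<subseteq> path_image (rectpath a c)"
  by (auto simp: rectpath_def Let_def b_def d_def path_image_join)

lemma contour_integrable_on_rectpath_edges:
  assumes "continuous_on (path_image (rectpath a c)) f"
  shows "f contour_integrable_on linepath a (Complex (Re c) (Im a))"
    "f contour_integrable_on linepath (Complex (Re c) (Im a)) c"
    "f contour_integrable_on linepath c (Complex (Re a) (Im c))"
    "f contour_integrable_on linepath (Complex (Re a) (Im c)) a"
  using rectpath_edges_subset_path_image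
  by (blast intro: contour_integrable_continuous_linepath continuous_on_subset[OF assms])+

lemma contour_integral_rectpath:
  assumes "continuous_on (path_image (rectpath a c)) f"
  shows "contour_integral (rectpath a c) f =
     contour_integral (linepath a (Complex (Re c) (Im a))) f +
     contour_integral (linepath (Complex (Re c) (Im a)) c) f +
     contour_integral (linepath c (Complex (Re a) (Im c))) f +
     contour_integral (linepath (Complex (Re a) (Im c)) a) f"
  using contour_integrable_on_rectpath_edges[OF assms]
  by (simp add: rectpath_def Let_def contour_integrable_joinI)

lemma residue_theorem_rectpath:
  assumes "Re a < Re b" "Im a < Im b" "open S" "connected S" "cbox a b \<subseteq> S"
    and "finite P" "P \<subseteq> box a b" "f holomorphic_on S - P"
  shows "contour_integral (rectpath a b) f = 2 * pi * \<i> * (\<Sum>p\<in>P. residue f p)"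
proof -
  have "path_image (rectpath a b) \<subseteq> S - P"
    using assms by (subst path_image_rectpath_cbox_minus_box) auto
  then have "contour_integral (rectpath a b) f =
      2 * pi * \<i> * (\<Sum>p\<in>P. winding_number (rectpath a b) p * residue f p)"
    using assms by (intro Residue_theorem[of S P]) (auto intro!: winding_number_rectpath_outside)
  also have "(\<Sum>p\<in>P. winding_number (rectpath a b) p * residue f p) = (\<Sum>p\<in>P. residue f p)"
    using assms(7) by (intro sum.cong) (auto simp: winding_number_rectpath)
  finally show ?thesis .
qed

lemma norm_contour_integral_horizontal_le:
  assumes "G contour_integrable_on linepath (Complex a T) (Complex b T)"
    and "\<And>s. min a b \<le> Re s \<Longrightarrow> Re s \<le> max a b \<Longrightarrow> Im s = T \<Longrightarrow> norm (G s) \<le> B" "B \<ge> 0"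
  shows "norm (contour_integral (linepath (Complex a T) (Complex b T)) G) \<le> B * \<bar>b - a\<bar>"
proof -
  have "norm (contour_integral (linepath (Complex a T) (Complex b T)) G) \<le>
      B * norm (Complex b T - Complex a T)"
    using assms
    by (intro contour_integral_bound_linepath)
       (auto simp: closed_segment_same_Im closed_segment_eq_real_ivl split: if_splits)
  then show ?thesis by (simp add: norm_complex_def)
qed

lemma vertical_segments_residue_error_le:
  assumes ab: "a < b" and T: "T > 0"
    and S: "open S" "connected S" "cbox (Complex a (- T)) (Complex b T) \<subseteq> S"
    and P: "finite P" "P \<subseteq> box (Complex a (- T)) (Complex b T)" and hol: "G holomorphic_on S - P"
    and B: "B \<ge> 0" "\<And>s. a \<le> Re s \<Longrightarrow> Re s \<le> b \<Longrightarrow> \<bar>Im s\<bar> = T \<Longrightarrow> norm (G s) \<le> B"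
  shows "norm (contour_integral (linepath (Complex b (- T)) (Complex b T)) G
      - contour_integral (linepath (Complex a (- T)) (Complex a T)) G
      - 2 * pi * \<i> * (\<Sum>p\<in>P. residue G p)) \<le> 2 * (b - a) * B"
proof -
  let ?I = "\<lambda>p q. contour_integral (linepath p q) G"
  let ?sw = "Complex a (- T)" and ?se = "Complex b (- T)"
    and ?ne = "Complex b T" and ?nw = "Complex a T"
  have "path_image (rectpath ?sw ?ne) \<subseteq> S - P"
    using ab T S(3) P(2) by (subst path_image_rectpath_cbox_minus_box) auto
  with holomorphic_on_imp_continuous_on[OF hol]
  have cont: "continuous_on (path_image (rectpath ?sw ?ne)) G" by (rule continuous_on_subset)
  have "?I ?sw ?se + ?I ?se ?ne + ?I ?ne ?nw + ?I ?nw ?sw = 2 * pi * \<i> * (\<Sum>p\<in>P. residue G p)"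
    using residue_theorem_rectpath[OF _ _ S P hol] contour_integral_rectpath[OF cont] ab T by simp
  moreover have "?I ?nw ?sw = - ?I ?sw ?nw"
    by (metis contour_integral_reversepath reversepath_linepath valid_path_linepath)
  ultimately have error: "?I ?se ?ne - ?I ?sw ?nw - 2 * pi * \<i> * (\<Sum>p\<in>P. residue G p) =
      - ?I ?sw ?se - ?I ?ne ?nw"
    by (simp add: algebra_simps)
  have "norm (- ?I ?sw ?se - ?I ?ne ?nw) \<le> norm (?I ?sw ?se) + norm (?I ?ne ?nw)"
    by (metis norm_minus_cancel norm_triangle_ineq4)
  also have "\<dots> \<le> B * (b - a) + B * (b - a)"
  proof (rule add_mono)
    show "norm (?I ?sw ?se) \<le> B * (b - a)"
      using norm_contour_integral_horizontal_le[of G a "- T" b B] B ab T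
        contour_integrable_on_rectpath_edges(1)[OF cont] by simp
    show "norm (?I ?ne ?nw) \<le> B * (b - a)"
      using norm_contour_integral_horizontal_le[of G b T a B] B ab T
        contour_integrable_on_rectpath_edges(3)[OF cont] by simp
  qed
  finally show ?thesis unfolding error by (simp add: algebra_simps)
qed

lemma open_vertical_strip: "open {s. a < Re s \<and> Re s < b}"
  by (intro open_Collect_conj open_Collect_less continuous_intros)

context
  fixes G :: "complex \<Rightarrow> complex" and a' a b b' \<beta> :: real and P :: "complex set"
  assumes strip: "a' < a" "a < b" "b < b'"
    and holomorphic: "G holomorphic_on {s. a' < Re s \<and> Re s < b'} - P"
    and poles: "finite P" "\<And>p. p \<in> P \<Longrightarrow> a < Re p \<and> Re p < b"
    and growth: "strip_growth a b \<beta> G" "\<beta> < 0"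
begin

lemma vertical_integrable_strip_edges: "vertical_integrable a G" "vertical_integrable b G"
  using strip poles(2) holomorphic_on_imp_continuous_on[OF holomorphic]
  by (fastforce intro: vertical_integrable_strip_growth[OF strip_growth_subset[OF growth(1)]
      growth(2)])+

lemma eventually_vertical_segments_residue_error_le:
  obtains M where "\<forall>\<^sub>F T in at_top.
    norm (contour_integral (linepath (Complex b (- T)) (Complex b T)) G
        - contour_integral (linepath (Complex a (- T)) (Complex a T)) G
        - 2 * pi * \<i> * (\<Sum>p\<in>P. residue G p)) \<le> M * exp (\<beta> * T)"
proof -
  obtain Y M where Y: "Y \<ge> 0" "M \<ge> 0"
    "\<And>s. a \<le> Re s \<Longrightarrow> Re s \<le> b \<Longrightarrow> Y \<le> \<bar>Im s\<bar> \<Longrightarrow> norm (G s) \<le> M * exp (\<beta> * \<bar>Im s\<bar>)"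
    using growth(1) by (elim strip_growthE) blast
  let ?S = "{s. a' < Re s \<and> Re s < b'}"
  have "?S = {s. a' < Re s} \<inter> {s. Re s < b'}" by auto
  then have "connected ?S"
    by (auto intro!: convex_connected convex_Int convex_halfspace_Re_gt convex_halfspace_Re_lt)
  have "\<forall>\<^sub>F T in at_top. T > 0 \<and> Y \<le> T \<and> (\<forall>p\<in>P. \<bar>Im p\<bar> < T)"
    using poles(1)
    by (intro eventually_conj eventually_ball_finite ballI eventually_gt_at_top
        eventually_ge_at_top)
  then have "\<forall>\<^sub>F T in at_top.
    norm (contour_integral (linepath (Complex b (- T)) (Complex b T)) G
        - contour_integral (linepath (Complex a (- T)) (Complex a T)) G
        - 2 * pi * \<i> * (\<Sum>p\<in>P. residue G p)) \<le> 2 * (b - a) * (M * exp (\<beta> * T))"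
  proof eventually_elim
    case (elim T)
    show ?case
    proof (rule vertical_segments_residue_error_le[OF strip(2) _ open_vertical_strip
        \<open>connected ?S\<close>])
      show "P \<subseteq> box (Complex a (- T)) (Complex b T)"
        using poles(2) elim by (auto simp: in_box_complex_iff abs_less_iff)
      show "norm (G s) \<le> M * exp (\<beta> * T)" if "a \<le> Re s" "Re s \<le> b" "\<bar>Im s\<bar> = T" for s
        using Y(3)[of s] that elim by simp
    qed (use elim strip poles(1) holomorphic Y(2) in \<open>auto simp: in_cbox_complex_iff\<close>)
  qed
  then show ?thesis by (intro that[of "2 * (b - a) * M"]) (simp add: mult.assoc)
qed

theorem vertical_residue_theorem:
  "vertical_integral b G - vertical_integral a G = 2 * pi * \<i> * (\<Sum>p\<in>P. residue G p)"
proof -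
  let ?R = "2 * pi * \<i> * (\<Sum>p\<in>P. residue G p)"
  define D where "D T = contour_integral (linepath (Complex b (- T)) (Complex b T)) G
      - contour_integral (linepath (Complex a (- T)) (Complex a T)) G - ?R" for T
  obtain M where M: "\<forall>\<^sub>F T in at_top. norm (D T) \<le> M * exp (\<beta> * T)"
    using eventually_vertical_segments_residue_error_le unfolding D_def by blast
  have "((\<lambda>T. M * exp (\<beta> * T)) \<longlongrightarrow> M * 0) at_top"
  proof (intro tendsto_mult tendsto_const filterlim_compose[OF exp_at_bot])
    show "filterlim (\<lambda>T. \<beta> * T) at_bot at_top"
      using tendsto_const growth(2) filterlim_ident by (rule filterlim_tendsto_neg_mult_at_bot)
  qed
  then have "(D \<longlongrightarrow> 0) at_top" using Lim_null_comparison[OF M] by simp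
  then have "(\<lambda>n. D (real n)) \<longlonglongrightarrow> 0"
    by (rule filterlim_compose[OF _ filterlim_real_sequentially])
  moreover have "(\<lambda>n. D (real n)) \<longlonglongrightarrow> vertical_integral b G - vertical_integral a G - ?R"
    unfolding D_def
    by (intro tendsto_diff tendsto_const vertical_segments_tendsto_vertical_integral
        vertical_integrable_strip_edges)
  ultimately have "vertical_integral b G - vertical_integral a G - ?R = 0"
    using LIMSEQ_unique by blast
  then show ?thesis by simp
qed

end

section \<open>Parametric integrals\<close>

lemma holomorphic_difference_bound:
  assumes "open S" "h holomorphic_on S" "cball z r \<subseteq> S" "r > 0"
    and B: "\<And>w. w \<in> cball z r \<Longrightarrow> norm (h w) \<le> B"
    and w: "w \<in> ball z (r / 2)"
  shows "norm (h w - h z) \<le> 2 * B / r * norm (w - z)"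
proof (rule field_differentiable_bound[of "ball z (r / 2)" h "deriv h"])
  fix v assume v: "v \<in> ball z (r / 2)"
  have inside: "cball v (r / 2) \<subseteq> cball z r"
  proof
    fix x assume "x \<in> cball v (r / 2)"
    then show "x \<in> cball z r" using v dist_triangle[of z x v] by auto
  qed
  then have hol: "h holomorphic_on cball v (r / 2)"
    using assms(2,3) by (blast intro: holomorphic_on_subset)
  have "norm ((deriv ^^ 1) h v) \<le> fact 1 * B / (r / 2) ^ 1"
  proof (rule Cauchy_inequality)
    show "h holomorphic_on ball v (r / 2)" using hol ball_subset_cball
      by (rule holomorphic_on_subset)
    show "continuous_on (cball v (r / 2)) h" using hol by (rule holomorphic_on_imp_continuous_on)
    show "norm (h x) \<le> B" if "norm (v - x) = r / 2" for x
      using that inside by (intro B) (auto simp: dist_norm)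
  qed (use \<open>r > 0\<close> in auto)
  then show "norm (deriv h v) \<le> 2 * B / r" by (simp add: mult.commute)
  have "v \<in> S" using v assms(3) \<open>r > 0\<close> by auto
  then show "(h has_field_derivative deriv h v) (at v within ball z (r / 2))"
    by (intro has_field_derivative_at_within[OF holomorphic_derivI[OF assms(2,1)]])
qed (use w \<open>r > 0\<close> in auto)

lemma tendsto_integral_dominated_at_within:
  fixes Q :: "'b::first_countable_topology \<Rightarrow> 'a \<Rightarrow> 'c::{banach, second_countable_topology}"
  assumes meas: "\<And>w. w \<in> A - {z} \<Longrightarrow> Q w \<in> borel_measurable M"
    and lim: "\<And>x. ((\<lambda>w. Q w x) \<longlongrightarrow> D x) (at z within A)"
    and b: "integrable M b" "\<And>w x. w \<in> A - {z} \<Longrightarrow> norm (Q w x) \<le> b x"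
  shows "((\<lambda>w. LINT x|M. Q w x) \<longlongrightarrow> (LINT x|M. D x)) (at z within A)"
  unfolding tendsto_at_iff_sequentially o_def
proof (intro allI impI)
  fix X assume X: "\<forall>i. X i \<in> A - {z}" "X \<longlonglongrightarrow> z"
  have meas_X: "Q (X i) \<in> borel_measurable M" for i using X(1) by (intro meas) blast
  have lim_X: "(\<lambda>i. Q (X i) x) \<longlonglongrightarrow> D x" for x
    using lim[of x] X by (simp add: tendsto_at_iff_sequentially o_def)
  have "D \<in> borel_measurable M" using meas_X lim_X by (rule borel_measurable_LIMSEQ_metric)
  then show "(\<lambda>i. LINT x|M. Q (X i) x) \<longlonglongrightarrow> (LINT x|M. D x)"
    using X(1) meas_X lim_X b by (intro integral_dominated_convergence[where w = b]) auto
qed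

lemma has_field_derivative_integral_dominated:
  fixes K :: "complex \<Rightarrow> 'a \<Rightarrow> complex"
  assumes "open S" and hol: "\<And>x. (\<lambda>w. K w x) holomorphic_on S"
    and meas: "\<And>w. w \<in> S \<Longrightarrow> K w \<in> borel_measurable M"
    and r: "r > 0" "cball z r \<subseteq> S"
    and b: "integrable M b" "\<And>w x. w \<in> cball z r \<Longrightarrow> norm (K w x) \<le> b x"
  shows "((\<lambda>w. LINT x|M. K w x) has_field_derivative (LINT x|M. deriv (\<lambda>w. K w x) z)) (at z)"
proof -
  define A where "A = ball z (r / 2)"
  define Q where "Q w x = (K w x - K z x) / (w - z)" for w x
  define D where "D x = deriv (\<lambda>w. K w x) z" for x
  have A: "open A" "z \<in> A" "A \<subseteq> cball z r" "A \<subseteq> S" using r by (auto simp: A_def)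
  have K_integrable: "integrable M (K w)" if "w \<in> A" for w
    using A that by (intro Bochner_Integration.integrable_bound[OF b(1)] AE_I2 meas)
      (auto intro!: order_trans[OF b(2) abs_ge_self])
  have Q_measurable: "Q w \<in> borel_measurable M" if "w \<in> A" for w
    unfolding Q_def using that A meas by (intro borel_measurable_divide borel_measurable_diff) auto
  have Q_tendsto: "((\<lambda>w. Q w x) \<longlongrightarrow> D x) (at z within A)" for x
    using holomorphic_derivI[OF hol \<open>open S\<close>, of z x] A(2,4) unfolding at_within_open[OF A(2,1)]
    by (simp add: Q_def D_def has_field_derivative_iff subset_iff)
  have "((\<lambda>w. LINT x|M. Q w x) \<longlongrightarrow> (LINT x|M. D x)) (at z within A)"
  proof (rule tendsto_integral_dominated_at_within[where b = "\<lambda>x. 2 * b x / r"])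
    show "norm (Q w x) \<le> 2 * b x / r" if "w \<in> A - {z}" for w x
      using holomorphic_difference_bound[OF \<open>open S\<close> hol r(2,1) b(2), of w x] that
      by (auto simp: A_def Q_def norm_divide pos_divide_le_eq)
  qed (use Q_measurable Q_tendsto b(1) in auto)
  moreover have "\<forall>\<^sub>F w in at z within A. (LINT x|M. Q w x) =
      ((LINT x|M. K w x) - (LINT x|M. K z x)) / (w - z)"
    using K_integrable A(2) by (auto simp: eventually_at_filter Q_def intro!: always_eventually)
  ultimately have "((\<lambda>w. ((LINT x|M. K w x) - (LINT x|M. K z x)) / (w - z)) \<longlongrightarrow>
      (LINT x|M. D x)) (at z within A)"
    by (rule Lim_transform_eventually)
  then show ?thesis
    unfolding D_def using at_within_open[OF A(2,1)] by (simp add: has_field_derivative_iff)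
qed

lemma holomorphic_on_integral_dominated:
  fixes K :: "complex \<Rightarrow> 'a \<Rightarrow> complex"
  assumes "open S" "\<And>x. (\<lambda>w. K w x) holomorphic_on S" "\<And>w. w \<in> S \<Longrightarrow> K w \<in> borel_measurable M"
    and dominated: "\<And>z. z \<in> S \<Longrightarrow> \<exists>r>0. \<exists>b. cball z r \<subseteq> S \<and> integrable M b \<and>
      (\<forall>w\<in>cball z r. \<forall>x. norm (K w x) \<le> b x)"
  shows "(\<lambda>w. LINT x|M. K w x) holomorphic_on S"
  unfolding holomorphic_on_def
proof
  fix z assume "z \<in> S"
  from dominated[OF this] obtain r b where "r > 0" "cball z r \<subseteq> S" "integrable M b"
    "\<And>w x. w \<in> cball z r \<Longrightarrow> norm (K w x) \<le> b x" by blast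
  from has_field_derivative_integral_dominated[OF assms(1-3) this]
  show "(\<lambda>w. LINT x|M. K w x) field_differentiable at z within S"
    unfolding field_differentiable_def by (blast intro: has_field_derivative_at_within)
qed

lemma (in pair_sigma_finite) integrable_product_bound:
  fixes K :: "'a \<Rightarrow> 'b \<Rightarrow> 'c :: {banach, second_countable_topology}"
  assumes K[measurable]: "case_prod K \<in> borel_measurable (M1 \<Otimes>\<^sub>M M2)"
    and p: "integrable M1 p" and q: "integrable M2 q"
    and bound: "\<And>x y. norm (K x y) \<le> p x * q y"
  shows "integrable (M1 \<Otimes>\<^sub>M M2) (case_prod K)"
proof (rule Fubini_integrable)
  have int: "integrable M2 (K x)" if "x \<in> space M1" for x
  proof (rule Bochner_Integration.integrable_bound[OF integrable_mult_right[OF q, of "p x"]])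
    show "K x \<in> borel_measurable M2"
      using measurable_compose[OF measurable_Pair1'[OF that] K] by simp
  qed (use bound in \<open>auto intro: order_trans[OF _ abs_ge_self]\<close>)
  then show "AE x in M1. integrable M2 (\<lambda>y. case_prod K (x, y))" by simp
  show "integrable M1 (\<lambda>x. LINT y|M2. norm (case_prod K (x, y)))"
  proof (rule Bochner_Integration.integrable_bound[OF
      integrable_mult_left[OF p, of "LINT y|M2. q y"]])
    show "AE x in M1. norm (LINT y|M2. norm (case_prod K (x, y))) \<le> norm (p x * (LINT y|M2. q y))"
    proof (rule AE_I2)
      fix x assume x: "x \<in> space M1"
      have "(LINT y|M2. norm (K x y)) \<le> (LINT y|M2. p x * q y)"
        using int[OF x] q bound by (intro integral_mono) auto
      then show "norm (LINT y|M2. norm (case_prod K (x, y))) \<le> norm (p x * (LINT y|M2. q y))"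
        by (simp add: abs_of_nonneg[OF integral_nonneg])
    qed
  qed measurable
qed fact

lemma vertical_integral_set_integral_swap:
  assumes [measurable]: "(\<lambda>(t, y). H t (Complex c y)) \<in> borel_measurable (lborel \<Otimes>\<^sub>M lborel)"
    "T \<in> sets borel"
    and p: "set_integrable lborel T p" and q: "vertical_integrable c q"
    and bound: "\<And>t s. t \<in> T \<Longrightarrow> Re s = c \<Longrightarrow> norm (H t s) \<le> p t * norm (q s)"
  shows "set_integrable lborel T (\<lambda>t. vertical_integral c (H t))"
    "(LINT t:T|lborel. vertical_integral c (H t)) =
        vertical_integral c (\<lambda>s. LINT t:T|lborel. H t s)"
proof -
  define K where "K t y = indicator T t *\<^sub>R H t (Complex c y)" for t y
  have int: "integrable (lborel \<Otimes>\<^sub>M lborel) (case_prod K)"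
  proof (rule lborel_pair.integrable_product_bound)
    show "integrable lborel (\<lambda>t. indicator T t *\<^sub>R p t)" using p by (simp add: set_integrable_def)
    show "integrable lborel (\<lambda>y. norm (q (Complex c y)))"
      using q by (simp add: vertical_integrable_def)
    show "norm (K t y) \<le> (indicator T t *\<^sub>R p t) * norm (q (Complex c y))" for t y
      using bound[of t "Complex c y"] by (simp add: K_def indicator_def)
  qed (simp add: K_def[abs_def])
  have line: "indicator T t *\<^sub>R vertical_integral c (H t) = \<i> * (LINT y|lborel. K t y)" for t
    by (simp add: K_def vertical_integral_def indicator_def)
  show "set_integrable lborel T (\<lambda>t. vertical_integral c (H t))"
    unfolding set_integrable_def line using lborel_pair.integrable_fst[OF int] by simp
  have "(LINT t:T|lborel. vertical_integral c (H t)) = \<i> * (LINT t|lborel. LINT y|lborel. K t y)"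
    by (simp add: set_lebesgue_integral_def line)
  also have "(LINT t|lborel. LINT y|lborel. K t y) = (LINT y|lborel. LINT t|lborel. K t y)"
    using lborel_pair.Fubini_integral[OF int] by simp
  finally show "(LINT t:T|lborel. vertical_integral c (H t)) =
      vertical_integral c (\<lambda>s. LINT t:T|lborel. H t s)"
    by (simp add: vertical_integral_def set_lebesgue_integral_def K_def)
qed

section \<open>Powers of a positive real variable\<close>

lemma has_vector_derivative_of_real_powr:
  assumes "t > 0"
  shows "((\<lambda>t. of_real t powr s) has_vector_derivative
      (s::complex) * of_real t powr (s - 1)) (at t)"
proof -
  have "((\<lambda>w. w powr s) has_field_derivative s * of_real t powr (s - 1)) (at (of_real t))"
    using assms by (intro has_field_derivative_powr) auto
  from has_vector_derivative_real_field[OF this] show ?thesis .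
qed

lemma isCont_of_real_powr: "t > 0 \<Longrightarrow> isCont (\<lambda>t. of_real t powr s :: complex) t"
  using has_vector_derivative_continuous[OF has_vector_derivative_of_real_powr] .

lemma tendsto_of_real_powr_at_right_0:
  assumes "Re s > 0"
  shows "((\<lambda>t. of_real t powr s :: complex) \<longlongrightarrow> 0) (at_right 0)"
proof -
  have "((\<lambda>t. complex_of_real (inverse t) powr - s) \<longlongrightarrow> 0) (at_right 0)"
    using assms by (intro tendsto_neg_powr_complex_of_real filterlim_inverse_at_top_right) simp
  then show ?thesis
  proof (rule Lim_transform_eventually)
    show "\<forall>\<^sub>F t in at_right 0. complex_of_real (inverse t) powr - s = of_real t powr s"
      using eventually_at_right_less[of "0::real"]
      by eventually_elim (simp add: powr_def Ln_of_real ln_inverse del: of_real_inverse)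
  qed
qed

lemma set_integrable_powr_at_right_0:
  assumes "p > -1" "c > 0"
  shows "set_integrable lborel {0<..<c} (\<lambda>t::real. t powr p)"
proof -
  have "set_integrable lborel {0..c} (\<lambda>t::real. t powr p)"
    using has_integral_powr_from_0[of p c] assms
    by (intro set_integrable_lborel_nonneg) (auto simp: integrable_on_def)
  then show ?thesis by (rule set_integrable_subset) auto
qed

lemma set_integrable_powr_at_top:
  assumes "p < -1" "c > 0"
  shows "set_integrable lborel {c..} (\<lambda>t::real. t powr p)"
  using has_integral_powr_to_inf[of p c] assms
  by (intro set_integrable_lborel_nonneg) (auto simp: integrable_on_def)

lemma set_integrable_of_real_powr:
  assumes "set_integrable lborel T (\<lambda>t. t powr Re s)" "T \<subseteq> {0<..}" "T \<in> sets borel"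
  shows "set_integrable lborel T (\<lambda>t. of_real t powr s :: complex)"
proof (rule set_integrable_bound[OF assms(1)])
  show "set_borel_measurable lborel T (\<lambda>t. of_real t powr s :: complex)"
    using assms(3) unfolding set_borel_measurable_def by measurable
  show "AE t in lborel. t \<in> T \<longrightarrow> norm (of_real t powr s :: complex) \<le> norm (t powr Re s)"
    using assms(2) by (intro AE_I2) (auto simp: norm_powr_real_powr)
qed

lemma interval_integral_of_real_powr:
  fixes w :: complex
  assumes "w \<noteq> 0" "0 \<le> a" "a < b"
    and "set_integrable lborel (einterval a b) (\<lambda>t. of_real t powr (w - 1) :: complex)"
    and A: "(((\<lambda>t. of_real t powr w) \<circ> real_of_ereal) \<longlongrightarrow> A) (at_right a)"
    and B: "(((\<lambda>t. of_real t powr w) \<circ> real_of_ereal) \<longlongrightarrow> B) (at_left b)"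
  shows "(LBINT t=a..b. of_real t powr (w - 1)) = (B - A) / w"
proof -
  have pos: "t > 0" if "a < ereal t" for t
    using order.strict_trans1[OF \<open>0 \<le> a\<close> that] by simp
  have "(LBINT t=a..b. of_real t powr (w - 1)) = B / w - A / w"
  proof (rule interval_integral_FTC_integrable[where F = "\<lambda>t. of_real t powr w / w"])
    show "((\<lambda>t. of_real t powr w / w) has_vector_derivative of_real t powr (w - 1)) (at t)"
      if "a < ereal t" for t
      using has_vector_derivative_divide[OF has_vector_derivative_of_real_powr, of t w w]
        pos[OF that] \<open>w \<noteq> 0\<close>
      by simp
    show "isCont (\<lambda>t. of_real t powr (w - 1) :: complex) t" if "a < ereal t" for t
      using pos[OF that] by (rule isCont_of_real_powr)
    show "(((\<lambda>t. of_real t powr w / w) \<circ> real_of_ereal) \<longlongrightarrow> A / w) (at_right a)"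
      using tendsto_divide[OF A tendsto_const \<open>w \<noteq> 0\<close>] by (simp add: o_def)
    show "(((\<lambda>t. of_real t powr w / w) \<circ> real_of_ereal) \<longlongrightarrow> B / w) (at_left b)"
      using tendsto_divide[OF B tendsto_const \<open>w \<noteq> 0\<close>] by (simp add: o_def)
  qed (use assms in auto)
  then show ?thesis by (simp add: diff_divide_distrib)
qed

lemma of_real_powr_tendsto_1: "((\<lambda>t. of_real t powr w :: complex) \<longlongrightarrow> 1) (at 1)"
  using isCont_of_real_powr[of 1 w] by (simp add: isCont_def)

lemma set_integral_of_real_powr_unit_interval:
  assumes "Re w > 0"
  shows "(LINT t:{0<..<1}|lborel. of_real t powr (w - 1)) = 1 / w"
proof -
  have "(LBINT t=ereal 0..ereal 1. of_real t powr (w - 1)) = (1 - 0) / w"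
  proof (rule interval_integral_of_real_powr)
    show "set_integrable lborel (einterval (ereal 0) (ereal 1))
        (\<lambda>t. of_real t powr (w - 1) :: complex)"
      using assms by (auto intro!: set_integrable_of_real_powr set_integrable_powr_at_right_0
          simp: einterval_eq_Icc)
  qed (use assms tendsto_of_real_powr_at_right_0[OF assms] of_real_powr_tendsto_1
      in \<open>auto simp: ereal_tendsto_simps filterlim_at_split zero_ereal_def\<close>)
  then show ?thesis
    by (simp add: interval_lebesgue_integral_def einterval_eq)
qed

lemma set_integral_of_real_powr_ge_1:
  assumes "Re w < 0"
  shows "(LINT t:{1..}|lborel. of_real t powr (w - 1)) = - 1 / w"
proof -
  have "(LBINT t=ereal 1..\<infinity>. of_real t powr (w - 1)) = (0 - 1) / w"
  proof (rule interval_integral_of_real_powr)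
    have "set_integrable lborel {1..} (\<lambda>t. of_real t powr (w - 1) :: complex)"
      using assms by (auto intro!: set_integrable_of_real_powr set_integrable_powr_at_top)
    then show "set_integrable lborel (einterval (ereal 1) \<infinity>)
        (\<lambda>t. of_real t powr (w - 1) :: complex)"
      by (rule set_integrable_subset) (auto simp: einterval_def)
  qed (use assms tendsto_neg_powr_complex_of_real[OF filterlim_ident assms] of_real_powr_tendsto_1
      in \<open>auto simp: ereal_tendsto_simps filterlim_at_split\<close>)
  then have "(LINT t:{1<..}|lborel. of_real t powr (w - 1)) = - 1 / w"
    by (simp add: interval_integral_to_infinity_eq)
  moreover have "(LINT t:{1..}|lborel. of_real t powr (w - 1)) =
      (LINT t:{1<..}|lborel. of_real t powr (w - 1))"
    unfolding set_lebesgue_integral_def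
    by (rule integral_discrete_difference[of "{1}"]) (auto simp: indicator_def)
  ultimately show ?thesis by simp
qed

lemma norm_exp_of_real_powr_derivative_le:
  fixes p :: complex
  assumes "0 < x" "x \<le> t"
  shows "norm (of_real (exp x) * (of_real x powr p + p * of_real x powr (p - 1)))
    \<le> exp t * (x powr Re p + x powr (Re p - 1)) * (1 + norm p)"
proof -
  have "norm (of_real x powr p + p * of_real x powr (p - 1)) \<le>
      x powr Re p + norm p * x powr (Re p - 1)"
    using norm_triangle_ineq[of "of_real x powr p" "p * of_real x powr (p - 1)"] assms
    by (simp add: norm_mult norm_powr_real_powr)
  also have "\<dots> \<le> (x powr Re p + x powr (Re p - 1)) * (1 + norm p)"
    by (simp add: algebra_simps)
  finally have "exp x * norm (of_real x powr p + p * of_real x powr (p - 1))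
      \<le> exp t * ((x powr Re p + x powr (Re p - 1)) * (1 + norm p))"
    using assms by (intro mult_mono) auto
  then show ?thesis by (simp add: norm_mult mult.assoc)
qed

lemma set_integrable_exp_powr_add_powr:
  assumes "p > 0" "t > 0"
  shows "set_integrable lborel {0<..<t} (\<lambda>x::real. exp t * (x powr p + x powr (p - 1)))"
  using assms by (intro set_integrable_mult_right set_integral_add set_integrable_powr_at_right_0)
    auto

lemma set_integral_exp_of_real_powr_derivative:
  fixes p :: complex and t :: real
  assumes "Re p > 0" "t > 0"
  shows "(LINT x:{0<..<t}|lborel. of_real (exp x) * (of_real x powr p + p * of_real x powr (p - 1)))
    = of_real (exp t) * of_real t powr p"
proof -
  let ?F = "\<lambda>x::real. of_real (exp x) * of_real x powr p :: complex"
  let ?f = "\<lambda>x::real. of_real (exp x) * (of_real x powr p + p * of_real x powr (p - 1)) :: complex"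
  have "(LBINT x=ereal 0..ereal t. ?f x) = ?F t - 0"
  proof (rule interval_integral_FTC_integrable[where F = ?F])
    have exp: "((\<lambda>x. of_real (exp x) :: complex) has_vector_derivative of_real (exp x)) (at x)"
      for x
      using has_vector_derivative_real_field[OF DERIV_exp] by (simp add: exp_of_real)
    show "(?F has_vector_derivative ?f x) (at x)" if "ereal 0 < ereal x" for x
      using that has_vector_derivative_mult[OF exp has_vector_derivative_of_real_powr[of x p]]
      by (simp add: algebra_simps)
    show "isCont ?f x" if "ereal 0 < ereal x" for x
      using that isCont_of_real_powr[of x p] isCont_of_real_powr[of x "p - 1"]
      by (intro continuous_intros) auto
    have "set_integrable lborel {0<..<t} (\<lambda>x. exp t * (x powr Re p + x powr (Re p - 1))
        * (1 + norm p))"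
      using set_integrable_exp_powr_add_powr[OF assms] by simp
    then have "set_integrable lborel {0<..<t} ?f"
    proof (rule set_integrable_bound)
      show "set_borel_measurable lborel {0<..<t} ?f"
        unfolding set_borel_measurable_def by measurable
    qed (use norm_exp_of_real_powr_derivative_le[of _ t p]
        in \<open>auto intro!: AE_I2 order_trans[OF _ abs_ge_self]\<close>)
    then show "set_integrable lborel (einterval (ereal 0) (ereal t)) ?f" by (simp add: einterval_eq)
    have "(?F \<longlongrightarrow> of_real (exp 0) * 0) (at_right 0)"
      using assms by (intro tendsto_intros tendsto_of_real_powr_at_right_0)
    then show "((?F \<circ> real_of_ereal) \<longlongrightarrow> 0) (at_right (ereal 0))"
      by (simp add: ereal_tendsto_simps)
    have "isCont ?F t" by (intro isCont_mult isCont_of_real_powr assms(2) continuous_intros)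
    then show "((?F \<circ> real_of_ereal) \<longlongrightarrow> ?F t) (at_left (ereal t))"
      by (simp add: ereal_tendsto_simps isCont_def filterlim_at_split)
  qed (use assms in auto)
  then show ?thesis using assms by (simp add: interval_lebesgue_integral_def einterval_eq)
qed

section \<open>Inverse Mellin transforms\<close>

definition inverse_mellin :: "real \<Rightarrow> (complex \<Rightarrow> complex) \<Rightarrow> real \<Rightarrow> complex" where
  "inverse_mellin c G x =
     1 / (2 * of_real pi * \<i>) * vertical_integral c (\<lambda>s. G s * of_real x powr (- s))"

lemma inverse_mellin_cong:
  "(\<And>s. Re s = c \<Longrightarrow> F s = G s) \<Longrightarrow> inverse_mellin c F x = inverse_mellin c G x"
  unfolding inverse_mellin_def
  by (intro arg_cong2[of _ _ _ _ "(*)"] vertical_integral_cong refl) simp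

lemma borel_measurable_Complex [measurable]:
  "f \<in> borel_measurable M \<Longrightarrow> (\<lambda>x. Complex c (f x)) \<in> borel_measurable M"
  unfolding Complex_eq by measurable

lemma borel_measurable_vertical_integrable:
  "vertical_integrable c G \<Longrightarrow> (\<lambda>y. G (Complex c y)) \<in> borel_measurable borel"
  by (auto simp: vertical_integrable_def dest: borel_measurable_integrable)

lemma vertical_integrable_mult_of_real_powr:
  assumes "vertical_integrable c G" "x > 0"
  shows "vertical_integrable c (\<lambda>s. G s * of_real x powr (- s))"
  unfolding vertical_integrable_def
proof (rule Bochner_Integration.integrable_bound)
  have [measurable]: "(\<lambda>y. G (Complex c y)) \<in> borel_measurable borel"
    using assms(1) by (rule borel_measurable_vertical_integrable)
  show "(\<lambda>y. G (Complex c y) * of_real x powr (- Complex c y)) \<in> borel_measurable lborel"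
    by measurable
  show "integrable lborel (\<lambda>y. x powr (- c) * norm (G (Complex c y)))"
    using assms(1) by (auto simp: vertical_integrable_def)
qed (use assms(2) in \<open>simp add: norm_mult norm_powr_real_powr\<close>)

lemma inverse_mellin_diff:
  assumes "vertical_integrable c F" "vertical_integrable c G" "x > 0"
  shows "inverse_mellin c (\<lambda>s. F s - G s) x = inverse_mellin c F x - inverse_mellin c G x"
  unfolding inverse_mellin_def left_diff_distrib
  using assms(1,2)[THEN vertical_integrable_mult_of_real_powr[OF _ assms(3)]]
  by (simp only: vertical_integral_diff right_diff_distrib)

lemma Complex_add_1: "Complex (c + 1) y = Complex c y + 1"
  by (simp add: complex_eq_iff)

lemma vertical_integrable_shift_argument:
  "vertical_integrable c G \<Longrightarrow> vertical_integrable (c + 1) (\<lambda>s. G (s - 1))"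
  by (simp add: vertical_integrable_def Complex_add_1)

lemma inverse_mellin_shift_argument:
  assumes "x > 0"
  shows "inverse_mellin (c + 1) (\<lambda>s. G (s - 1)) x = inverse_mellin c G x / of_real x"
proof -
  have "of_real x powr (- (s + 1)) = of_real x powr (- s) / (of_real x :: complex)" for s
    using assms powr_diff[of "of_real x :: complex" "- s" 1] by simp
  then show ?thesis
    by (simp add: inverse_mellin_def vertical_integral_def Complex_add_1 del: minus_add_distrib)
qed

lemma set_integral_powr_inverse_mellin:
  assumes T: "T \<subseteq> {0<..}" "T \<in> sets borel" and G: "vertical_integrable c G"
    and powr: "set_integrable lborel T (\<lambda>t. t powr (Re z - c - 1))"
  shows "set_integrable lborel T (\<lambda>t. of_real t powr (z - 1) * inverse_mellin c G t)"
    "(LINT t:T|lborel. of_real t powr (z - 1) * inverse_mellin c G t) =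
       1 / (2 * of_real pi * \<i>) * vertical_integral c
         (\<lambda>s. G s * (LINT t:T|lborel. of_real t powr (z - s - 1)))"
proof -
  define H where "H t s = G s * of_real t powr (z - s - 1)" for t :: real and s
  have "vertical_integral c (H t) =
      of_real t powr (z - 1) * vertical_integral c (\<lambda>s. G s * of_real t powr (- s))" for t
  proof -
    have "H t = (\<lambda>s. of_real t powr (z - 1) * (G s * of_real t powr (- s)))"
    proof
      show "H t s = of_real t powr (z - 1) * (G s * of_real t powr (- s))" for s
        using powr_add[of "of_real t :: complex" "z - 1" "- s"] by (simp add: H_def algebra_simps)
    qed
    then show ?thesis by (simp only: vertical_integral_mult_right)
  qed
  then have integrand: "of_real t powr (z - 1) * inverse_mellin c G t =
      1 / (2 * of_real pi * \<i>) * vertical_integral c (H t)" for t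
    by (simp add: inverse_mellin_def)
  have [measurable]: "(\<lambda>y. G (Complex c y)) \<in> borel_measurable borel"
    using G by (rule borel_measurable_vertical_integrable)
  have meas: "(\<lambda>(t, y). H t (Complex c y)) \<in> borel_measurable (lborel \<Otimes>\<^sub>M lborel)"
    unfolding H_def by measurable
  have bound: "norm (H t s) \<le> t powr (Re z - c - 1) * norm (G s)" if "t \<in> T" "Re s = c" for t s
    using that T(1) by (auto simp: H_def norm_mult norm_powr_real_powr mult.commute)
  note swap = vertical_integral_set_integral_swap[OF meas T(2) powr G bound]
  show "set_integrable lborel T (\<lambda>t. of_real t powr (z - 1) * inverse_mellin c G t)"
    unfolding integrand using swap(1) by simp
  have "(LINT t:T|lborel. of_real t powr (z - 1) * inverse_mellin c G t) =
      1 / (2 * of_real pi * \<i>) * vertical_integral c (\<lambda>s. LINT t:T|lborel. H t s)"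
    unfolding integrand by (simp add: swap(2))
  then show "(LINT t:T|lborel. of_real t powr (z - 1) * inverse_mellin c G t) =
      1 / (2 * of_real pi * \<i>) * vertical_integral c
        (\<lambda>s. G s * (LINT t:T|lborel. of_real t powr (z - s - 1)))"
    by (simp add: H_def)
qed

lemma set_integral_powr_inverse_mellin_unit_interval:
  assumes "vertical_integrable c G" "c < Re z"
  shows "set_integrable lborel {0<..<1} (\<lambda>t. of_real t powr (z - 1) * inverse_mellin c G t)"
    "(LINT t:{0<..<1}|lborel. of_real t powr (z - 1) * inverse_mellin c G t) =
       1 / (2 * of_real pi * \<i>) * vertical_integral c (\<lambda>s. G s / (z - s))"
proof -
  have "set_integrable lborel {0<..<1} (\<lambda>t. t powr (Re z - c - 1))"
    using assms by (intro set_integrable_powr_at_right_0) auto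
  note mellin = set_integral_powr_inverse_mellin[OF _ _ assms(1) this]
  show "set_integrable lborel {0<..<1} (\<lambda>t. of_real t powr (z - 1) * inverse_mellin c G t)"
    by (rule mellin) auto
  have "vertical_integral c (\<lambda>s. G s * (LINT t:{0<..<1}|lborel. of_real t powr (z - s - 1))) =
      vertical_integral c (\<lambda>s. G s / (z - s))"
    using assms(2) by (intro vertical_integral_cong)
      (simp add: set_integral_of_real_powr_unit_interval)
  then show "(LINT t:{0<..<1}|lborel. of_real t powr (z - 1) * inverse_mellin c G t) =
      1 / (2 * of_real pi * \<i>) * vertical_integral c (\<lambda>s. G s / (z - s))"
    by (subst mellin(2)) auto
qed

lemma set_integral_powr_inverse_mellin_ge_1:
  assumes "vertical_integrable c G" "Re z < c"
  shows "set_integrable lborel {1..} (\<lambda>t. of_real t powr (z - 1) * inverse_mellin c G t)"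
    "(LINT t:{1..}|lborel. of_real t powr (z - 1) * inverse_mellin c G t) =
       1 / (2 * of_real pi * \<i>) * vertical_integral c (\<lambda>s. G s / (s - z))"
proof -
  have "set_integrable lborel {1..} (\<lambda>t. t powr (Re z - c - 1))"
    using assms by (intro set_integrable_powr_at_top) auto
  note mellin = set_integral_powr_inverse_mellin[OF _ _ assms(1) this]
  show "set_integrable lborel {1..} (\<lambda>t. of_real t powr (z - 1) * inverse_mellin c G t)"
    by (rule mellin) auto
  have "vertical_integral c (\<lambda>s. G s * (LINT t:{1..}|lborel. of_real t powr (z - s - 1))) =
      vertical_integral c (\<lambda>s. G s / (s - z))"
  proof (rule vertical_integral_cong)
    fix s assume "Re s = c"
    then show "G s * (LINT t:{1..}|lborel. of_real t powr (z - s - 1)) = G s / (s - z)"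
      using assms(2) set_integral_of_real_powr_ge_1[of "z - s"] minus_divide_right[of "G s" "z - s"]
      by simp
  qed
  then show "(LINT t:{1..}|lborel. of_real t powr (z - 1) * inverse_mellin c G t) =
      1 / (2 * of_real pi * \<i>) * vertical_integral c (\<lambda>s. G s / (s - z))"
    by (subst mellin(2)) auto
qed

lemma exp_inverse_mellin_derivative_eq:
  assumes x: "x > 0" and G: "vertical_integrable c G" "vertical_integrable c (\<lambda>s. s * G s)"
  shows "of_real (exp x) * (inverse_mellin c G x - inverse_mellin c (\<lambda>s. s * G s) x / of_real x) =
    1 / (2 * of_real pi * \<i>) * vertical_integral c
      (\<lambda>s. G s * (of_real (exp x) * (of_real x powr (- s) + (- s) * of_real x powr (- s - 1))))"
proof -
  let ?F = "\<lambda>s. G s * of_real x powr (- s)" and ?F' = "\<lambda>s. s * G s * of_real x powr (- s)"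
  have "of_real x powr (- s - 1) = of_real x powr (- s) / (of_real x :: complex)" for s
    using x by (simp add: powr_diff)
  then have "(\<lambda>s. G s * (of_real (exp x)
      * (of_real x powr (- s) + (- s) * of_real x powr (- s - 1)))) =
      (\<lambda>s. of_real (exp x) * (?F s - 1 / of_real x * ?F' s))"
    by (simp add: fun_eq_iff algebra_simps)
  moreover have "vertical_integral c (\<lambda>s. ?F s - 1 / of_real x * ?F' s) =
      vertical_integral c ?F - 1 / of_real x * vertical_integral c ?F'"
    using G[THEN vertical_integrable_mult_of_real_powr[OF _ x]]
    unfolding vertical_integral_mult_right[symmetric]
    by (intro vertical_integral_diff) (auto simp: vertical_integrable_def)
  ultimately show ?thesis
    by (simp only: vertical_integral_mult_right inverse_mellin_def) (simp add: field_simps)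
qed

lemma set_integral_exp_inverse_mellin:
  assumes "c < 0" "t > 0" and G: "vertical_integrable c G" "vertical_integrable c (\<lambda>s. s * G s)"
  defines "w x \<equiv> of_real (exp x)
      * (inverse_mellin c G x - inverse_mellin c (\<lambda>s. s * G s) x / of_real x)"
  shows "set_integrable lborel {0<..<t} w"
    "(LINT x:{0<..<t}|lborel. w x) = of_real (exp t) * inverse_mellin c G t"
proof -
  define H where "H x s = G s * (of_real (exp x)
      * (of_real x powr (- s) + (- s) * of_real x powr (- s - 1)))"
    for x :: real and s
  have w_eq: "w x = 1 / (2 * of_real pi * \<i>) * vertical_integral c (H x)" if "x \<in> {0<..<t}" for x
    using exp_inverse_mellin_derivative_eq[OF _ G, of x] that by (simp add: w_def H_def[abs_def])
  have [measurable]: "(\<lambda>y. G (Complex c y)) \<in> borel_measurable borel"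
    using G(1) by (rule borel_measurable_vertical_integrable)
  have meas: "(\<lambda>(x, y). H x (Complex c y)) \<in> borel_measurable (lborel \<Otimes>\<^sub>M lborel)"
    unfolding H_def by measurable
  have powr: "set_integrable lborel {0<..<t} (\<lambda>x. exp t * (x powr (- c) + x powr (- c - 1)))"
    using assms by (intro set_integrable_exp_powr_add_powr) auto
  have dominating: "vertical_integrable c (\<lambda>s. of_real ((1 + norm s) * norm (G s)))"
    using G by (auto simp: vertical_integrable_def distrib_right norm_mult
        intro: integrable_norm simp flip: norm_mult)
  have bound: "norm (H x s) \<le> exp t * (x powr (- c) + x powr (- c - 1)) *
      norm (of_real ((1 + norm s) * norm (G s)) :: complex)" if "x \<in> {0<..<t}" "Re s = c" for x s
    using mult_left_mono[OF norm_exp_of_real_powr_derivative_le[of x t "- s"], of "norm (G s)"] that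
    by (simp add: H_def norm_mult mult_ac del: of_real_mult of_real_add)
  have interval: "{0<..<t} \<in> sets borel" by simp
  note swap = vertical_integral_set_integral_swap[OF meas interval powr dominating bound]
  have "set_integrable lborel {0<..<t} (\<lambda>x. 1 / (2 * of_real pi * \<i>) * vertical_integral c (H x))"
    by (intro set_integrable_mult_right swap(1))
  also have "?this \<longleftrightarrow> set_integrable lborel {0<..<t} w"
    by (intro set_integrable_cong) (auto simp: w_eq)
  finally show "set_integrable lborel {0<..<t} w" .
  have "(LINT x:{0<..<t}|lborel. w x) =
      (LINT x:{0<..<t}|lborel. 1 / (2 * of_real pi * \<i>) * vertical_integral c (H x))"
    by (intro set_lebesgue_integral_cong) (auto simp: w_eq)
  also have "\<dots> = 1 / (2 * of_real pi * \<i>) * vertical_integral c (\<lambda>s. LINT x:{0<..<t}|lborel. H x s)"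
    unfolding set_integral_mult_right by (intro arg_cong2[of _ _ _ _ "(*)"] refl swap(2))
  also have "vertical_integral c (\<lambda>s. LINT x:{0<..<t}|lborel. H x s) =
      vertical_integral c (\<lambda>s. of_real (exp t) * (G s * of_real t powr (- s)))"
    using set_integral_exp_of_real_powr_derivative[of "- _" t] assms
    by (intro vertical_integral_cong) (simp add: H_def del: of_real_exp)
  finally show "(LINT x:{0<..<t}|lborel. w x) = of_real (exp t) * inverse_mellin c G t"
    by (simp add: inverse_mellin_def vertical_integral_mult_right del: of_real_exp)
qed

definition decays_on_strip :: "real \<Rightarrow> real \<Rightarrow> (complex \<Rightarrow> complex) \<Rightarrow> bool" where
  "decays_on_strip l u G \<longleftrightarrow> G holomorphic_on {s. l < Re s \<and> Re s < u} \<and>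
     (\<forall>a b. l < a \<longrightarrow> b < u \<longrightarrow> (\<exists>\<beta><0. strip_growth a b \<beta> G))"

lemma decays_on_stripE:
  assumes "decays_on_strip l u G" "l < a" "b < u"
  obtains \<beta> where "\<beta> < 0" "strip_growth a b \<beta> G"
  using assms unfolding decays_on_strip_def by blast

lemma decays_on_strip_ident_mult:
  assumes "decays_on_strip l u G"
  shows "decays_on_strip l u (\<lambda>s. s * G s)"
proof -
  have "\<exists>\<beta><0. strip_growth a b \<beta> (\<lambda>s. s * G s)" if ab: "l < a" "b < u" for a b
  proof -
    obtain \<beta> where "\<beta> < 0" "strip_growth a b \<beta> G"
      using assms ab by (rule decays_on_stripE)
    then have "strip_growth a b (- \<beta> / 2 + \<beta>) (\<lambda>s. (s + 0) * G s)"
      by (intro strip_growth_mult strip_growth_add_const) auto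
    then show ?thesis using \<open>\<beta> < 0\<close> by (intro exI[of _ "- \<beta> / 2 + \<beta>"]) simp
  qed
  then show ?thesis
    using assms by (auto simp: decays_on_strip_def intro!: holomorphic_intros)
qed

lemma vertical_integrable_decays_on_strip:
  assumes "decays_on_strip l u G" "l < c" "c < u"
  shows "vertical_integrable c G"
proof -
  obtain \<beta> where \<beta>: "\<beta> < 0" "strip_growth c c \<beta> G"
    using assms by (rule decays_on_stripE)
  have "continuous_on {s. l < Re s \<and> Re s < u} G"
    using assms(1) by (simp add: decays_on_strip_def holomorphic_on_imp_continuous_on)
  then show ?thesis
    by (rule vertical_integrable_strip_growth[OF \<beta>(2,1)]) (use assms in auto)
qed

lemma inverse_mellin_line_independent:
  assumes G: "decays_on_strip l u G" and a: "l < a" "a < u" and b: "l < b" "b < u" and x: "x > 0"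
  shows "inverse_mellin a G x = inverse_mellin b G x"
proof -
  have shift: "inverse_mellin a G x = inverse_mellin b G x" if ab: "l < a" "a < b" "b < u" for a b
  proof -
    let ?K = "\<lambda>s. G s * of_real x powr (- s)"
    obtain \<beta> where \<beta>: "\<beta> < 0" "strip_growth a b \<beta> G"
      using G ab(1,3) by (rule decays_on_stripE)
    have "?K holomorphic_on {s. l < Re s \<and> Re s < u} - {}"
      using G x unfolding decays_on_strip_def by (auto intro!: holomorphic_intros)
    moreover have "strip_growth a b (\<beta> + 0) ?K"
      using \<beta>(2) x by (intro strip_growth_mult strip_growth_of_real_powr)
    ultimately have "vertical_integral b ?K - vertical_integral a ?K =
        2 * pi * \<i> * (\<Sum>p\<in>{}. residue ?K p)"
      using ab \<beta>(1) by (intro vertical_residue_theorem) auto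
    then show ?thesis by (simp add: inverse_mellin_def)
  qed
  consider (less) "a < b" | (equal) "a = b" | (greater) "b < a" by linarith
  then show ?thesis
  proof cases
    case less
    show ?thesis by (rule shift[OF a(1) less b(2)])
  next
    case equal
    then show ?thesis by (simp only:)
  next
    case greater
    show ?thesis by (rule shift[OF b(1) greater a(2), symmetric])
  qed
qed

lemma vertical_Cauchy_integral_formula:
  assumes G: "decays_on_strip l u G" and ab: "l < a" "a < Re z" "Re z < b" "b < u"
  shows "vertical_integral b (\<lambda>s. G s / (s - z)) - vertical_integral a (\<lambda>s. G s / (s - z)) =
    2 * pi * \<i> * G z"
proof -
  have hol: "G holomorphic_on {s. l < Re s \<and> Re s < u}" using G by (simp add: decays_on_strip_def)
  obtain \<beta> where \<beta>: "\<beta> < 0" "strip_growth a b \<beta> G"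
    using G ab(1,4) by (rule decays_on_stripE)
  then have "strip_growth a b (\<beta> + 0) (\<lambda>s. G s * (1 / (s - z)))"
    by (intro strip_growth_mult strip_growth_inverse_diff)
  then have "vertical_integral b (\<lambda>s. G s / (s - z)) - vertical_integral a (\<lambda>s. G s / (s - z)) =
      2 * pi * \<i> * (\<Sum>p\<in>{z}. residue (\<lambda>s. G s / (s - z)) p)"
    using ab \<beta>(1) hol
    by (intro vertical_residue_theorem)
      (auto intro!: holomorphic_intros intro: holomorphic_on_subset)
  moreover have "residue (\<lambda>s. G s / (s - z)) z = G z"
    using hol ab by (intro residue_simple[OF open_vertical_strip[of l u]]) auto
  ultimately show ?thesis by simp
qed

theorem mellin_inversion:
  assumes G: "decays_on_strip l u G" and c: "l < c" "c < u" and z: "l < Re z" "Re z < u"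
  shows "set_integrable lborel {0<..} (\<lambda>t. of_real t powr (z - 1) * inverse_mellin c G t)"
    "(LINT t:{0<..}|lborel. of_real t powr (z - 1) * inverse_mellin c G t) = G z"
proof -
  let ?h = "\<lambda>d t. of_real t powr (z - 1) * inverse_mellin d G t"
  obtain a b where ab: "l < a" "a < Re z" "Re z < b" "b < u"
    using dense[OF z(1)] dense[OF z(2)] by blast
  have h_a: "?h c t = ?h a t" and h_b: "?h c t = ?h b t" if "t > 0" for t
    using ab c that inverse_mellin_line_independent[OF G, of c a t]
      inverse_mellin_line_independent[OF G, of c b t]
    by simp_all
  have "vertical_integrable a G" "vertical_integrable b G"
    using ab by (auto intro: vertical_integrable_decays_on_strip[OF G])
  note unit_interval = set_integral_powr_inverse_mellin_unit_interval[OF this(1) ab(2)]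
    and ge_1 = set_integral_powr_inverse_mellin_ge_1[OF this(2) ab(3)]
  have "set_integrable lborel {0<..<1} (?h c) \<longleftrightarrow> set_integrable lborel {0<..<1} (?h a)"
    by (intro set_integrable_cong refl h_a) simp
  moreover have "set_integrable lborel {1..} (?h c) \<longleftrightarrow> set_integrable lborel {1..} (?h b)"
    by (intro set_integrable_cong refl h_b) simp
  ultimately have int: "set_integrable lborel {0<..<1} (?h c)" "set_integrable lborel {1..} (?h c)"
    using unit_interval(1) ge_1(1) by blast+
  have halves: "{0<..} = {0<..<1} \<union> {1::real..}" by auto
  show "set_integrable lborel {0<..} (?h c)"
    unfolding halves by (rule set_integrable_Un[OF int]) auto
  have "(LINT t:{0<..}|lborel. ?h c t) =
      (LINT t:{0<..<1}|lborel. ?h c t) + (LINT t:{1..}|lborel. ?h c t)"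
    unfolding halves by (rule set_integral_Un[OF _ int]) auto
  also have "(LINT t:{0<..<1}|lborel. ?h c t) =
      1 / (2 * of_real pi * \<i>) * vertical_integral a (\<lambda>s. G s / (z - s))"
    unfolding unit_interval(2)[symmetric] by (intro set_lebesgue_integral_cong) (auto simp: h_a)
  also have "(LINT t:{1..}|lborel. ?h c t) =
      1 / (2 * of_real pi * \<i>) * vertical_integral b (\<lambda>s. G s / (s - z))"
    unfolding ge_1(2)[symmetric] by (intro set_lebesgue_integral_cong) (auto simp: h_b)
  also have "vertical_integral a (\<lambda>s. G s / (z - s)) = - vertical_integral a (\<lambda>s. G s / (s - z))"
  proof -
    have "G s / (z - s) = - (G s / (s - z))" for s
      using minus_divide_right[of "G s" "s - z"] by simp
    then show ?thesis by (simp only: vertical_integral_minus)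
  qed
  also have "1 / (2 * of_real pi * \<i>) * - vertical_integral a (\<lambda>s. G s / (s - z)) +
      1 / (2 * of_real pi * \<i>) * vertical_integral b (\<lambda>s. G s / (s - z)) =
      1 / (2 * of_real pi * \<i>) * (2 * pi * \<i> * G z)"
    unfolding vertical_Cauchy_integral_formula[OF G ab, symmetric] by (simp add: algebra_simps)
  finally show "(LINT t:{0<..}|lborel. ?h c t) = G z" by simp
qed

section \<open>Bounds for the sine\<close>

lemma norm_sin_squared_eq: "(norm (sin (w::complex)))\<^sup>2 = (sin (Re w))\<^sup>2 + (sinh (Im w))\<^sup>2"
proof -
  have "(norm (sin w))\<^sup>2 = (sin (Re w))\<^sup>2 * (cosh (Im w))\<^sup>2 + (cos (Re w))\<^sup>2 * (sinh (Im w))\<^sup>2"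
    by (simp add: cmod_power2 Re_sin Im_sin cosh_field_def sinh_field_def power_mult_distrib
        power_divide)
  also have "\<dots> = (sin (Re w))\<^sup>2 * (1 + (sinh (Im w))\<^sup>2) + (1 - (sin (Re w))\<^sup>2) * (sinh (Im w))\<^sup>2"
    by (simp add: cosh_square_eq cos_squared_eq)
  finally show ?thesis by (simp add: algebra_simps)
qed

lemma norm_sin_pi_le: "norm (sin (of_real pi * w :: complex)) \<le> exp (pi * \<bar>Im w\<bar>)"
proof (rule power2_le_imp_le)
  have "(norm (sin (of_real pi * w)))\<^sup>2 \<le> 1 + (sinh (pi * Im w))\<^sup>2"
    by (simp add: norm_sin_squared_eq abs_square_le_1)
  also have "\<dots> = (cosh (pi * Im w))\<^sup>2" by (simp add: cosh_square_eq)
  also have "\<dots> \<le> (exp (pi * \<bar>Im w\<bar>))\<^sup>2"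
  proof (rule power_mono)
    have "cosh x \<le> exp \<bar>x\<bar>" for x :: real
      by (cases "x \<ge> 0") (auto simp: cosh_field_def)
    from this[of "pi * Im w"] show "cosh (pi * Im w) \<le> exp (pi * \<bar>Im w\<bar>)" by (simp add: abs_mult)
  qed simp
  finally show "(norm (sin (of_real pi * w)))\<^sup>2 \<le> (exp (pi * \<bar>Im w\<bar>))\<^sup>2" .
qed simp

lemma norm_sin_pi_ge:
  "\<bar>sin (pi * Re w)\<bar> / 2 * exp (pi * \<bar>Im w\<bar>) \<le> norm (sin (of_real pi * w :: complex))"
proof -
  have "exp \<bar>x\<bar> \<le> 2 * cosh x" for x :: real by (cases "x \<ge> 0") (auto simp: cosh_field_def)
  from this[of "pi * Im w"] have "exp (pi * \<bar>Im w\<bar>) \<le> 2 * cosh (pi * Im w)" by (simp add: abs_mult)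
  from mult_left_mono[OF this, of "\<bar>sin (pi * Re w)\<bar> / 2"]
  have "\<bar>sin (pi * Re w)\<bar> / 2 * exp (pi * \<bar>Im w\<bar>) \<le> \<bar>sin (pi * Re w)\<bar> * cosh (pi * Im w)" by simp
  also have "\<dots> \<le> norm (sin (of_real pi * w))"
  proof (rule power2_le_imp_le)
    have "(\<bar>sin (pi * Re w)\<bar> * cosh (pi * Im w))\<^sup>2 =
        (sin (pi * Re w))\<^sup>2 + (sin (pi * Re w))\<^sup>2 * (sinh (pi * Im w))\<^sup>2"
      by (simp add: power_mult_distrib cosh_square_eq algebra_simps)
    also have "\<dots> \<le> (sin (pi * Re w))\<^sup>2 + 1 * (sinh (pi * Im w))\<^sup>2"
      by (intro add_left_mono mult_right_mono) (auto simp: abs_square_le_1)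
    finally show "(\<bar>sin (pi * Re w)\<bar> * cosh (pi * Im w))\<^sup>2 \<le> (norm (sin (of_real pi * w)))\<^sup>2"
      by (simp add: norm_sin_squared_eq)
  qed simp
  finally show ?thesis .
qed

lemma norm_sin_pi_ge_away_from_real_axis:
  assumes "\<bar>Im w\<bar> \<ge> 1"
  shows "1 / 4 * exp (pi * \<bar>Im w\<bar>) \<le> norm (sin (of_real pi * w :: complex))"
proof -
  define x where "x = pi * \<bar>Im w\<bar>"
  have "1 * 1 \<le> x" using assms pi_gt3 unfolding x_def by (intro mult_mono) auto
  then have "2 * exp (- x) \<le> 2" by simp
  also have "2 \<le> exp x" using \<open>1 * 1 \<le> x\<close> exp_ge_add_one_self[of x] by linarith
  finally have "1 / 4 * exp x \<le> sinh x" by (simp add: sinh_field_def)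
  also have "\<dots> \<le> norm (sin (of_real pi * w))"
  proof (rule power2_le_imp_le)
    have "(sinh x)\<^sup>2 = (sinh (pi * Im w))\<^sup>2" unfolding x_def by (cases "Im w \<ge> 0") auto
    then show "(sinh x)\<^sup>2 \<le> (norm (sin (of_real pi * w)))\<^sup>2" by (simp add: norm_sin_squared_eq)
  qed simp
  finally show ?thesis unfolding x_def .
qed

lemma sin_pi_mono_toward_half:
  fixes x r :: real
  assumes "0 \<le> r" "r \<le> x" "x \<le> 1 - r"
  shows "sin (pi * r) \<le> sin (pi * x)"
proof -
  have increasing: "sin (pi * r) \<le> sin (pi * u)" if "r \<le> u" "u \<le> 1/2" for u
  proof (rule sin_monotone_2pi_le)
    show "- (pi / 2) \<le> pi * r" "pi * r \<le> pi * u" using assms(1) that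
      by (auto intro: order_trans[of _ 0])
    show "pi * u \<le> pi / 2" using mult_left_mono[OF that(2), of pi] by simp
  qed
  have "sin (pi * (1 - x)) = sin (pi * x)" by (simp add: right_diff_distrib)
  then show ?thesis using increasing[of x] increasing[of "1 - x"] assms by (cases "x \<le> 1/2") auto
qed

lemma sin_pi_eq_0_iff: "sin (of_real pi * w :: complex) = 0 \<longleftrightarrow> w \<in> \<int>"
proof -
  have "sin (of_real pi * w) = 0 \<longleftrightarrow> (\<exists>n::int. of_real pi * w = of_real (real_of_int n * pi))"
    by (simp add: sin_eq_0)
  also have "\<dots> \<longleftrightarrow> (\<exists>n::int. w = of_int n)" by (auto simp: mult.commute)
  finally show ?thesis by (auto elim!: Ints_cases)
qed

section \<open>Decay of the Gamma function on vertical strips\<close>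

lemma norm_pochhammer: "norm (pochhammer (s::complex) n) = (\<Prod>i<n. norm (s + of_nat i))"
  by (simp add: pochhammer_prod prod_norm atLeast0LessThan)

lemma Gamma_add_of_nat:
  fixes s :: complex
  assumes "s \<notin> \<int>\<^sub>\<le>\<^sub>0"
  shows "Gamma (s + of_nat n) = pochhammer s n * Gamma s"
  using pochhammer_Gamma[OF assms, of n] assms by (simp add: Gamma_eq_zero_iff)

lemma nonpos_Ints_Im_eq_0: "s \<in> \<int>\<^sub>\<le>\<^sub>0 \<Longrightarrow> Im s = 0"
  by (auto elim: nonpos_Ints_cases)

lemma Re_pos_not_nonpos_Ints: "Re s > 0 \<Longrightarrow> s \<notin> \<int>\<^sub>\<le>\<^sub>0"
  by (auto elim!: nonpos_Ints_cases)

lemma Re_divide_norm_mono: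
  assumes "0 < p" "p \<le> q"
  shows "p / norm (Complex p y) \<le> q / norm (Complex q y)"
proof -
  have "p * sqrt (q\<^sup>2 + y\<^sup>2) = sqrt (p\<^sup>2 * (q\<^sup>2 + y\<^sup>2))"
    using assms by (simp add: real_sqrt_mult)
  also have "\<dots> \<le> sqrt (q\<^sup>2 * (p\<^sup>2 + y\<^sup>2))"
    using assms by (auto simp: algebra_simps intro!: mult_right_mono power_mono)
  also have "\<dots> = q * sqrt (p\<^sup>2 + y\<^sup>2)"
    using assms by (simp add: real_sqrt_mult)
  finally have "p * sqrt (q\<^sup>2 + y\<^sup>2) \<le> q * sqrt (p\<^sup>2 + y\<^sup>2)" .
  moreover have "sqrt (p\<^sup>2 + y\<^sup>2) > 0" "sqrt (q\<^sup>2 + y\<^sup>2) > 0"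
    using assms by (auto simp: add_pos_nonneg)
  ultimately show ?thesis
    unfolding norm_complex_def by (simp add: divide_simps)
qed

lemma norm_Gamma_series_divide:
  fixes x :: real
  assumes "x > 0" "n > 0"
  shows "norm (Gamma_series (Complex x y) n) / Gamma_series x n =
    (\<Prod>i<n+1. (x + real i) / norm (Complex (x + real i) y))"
proof -
  have shift: "Complex x y + of_nat i = Complex (x + real i) y" for i by (simp add: complex_eq_iff)
  have "norm (pochhammer (Complex x y) (n+1)) > 0"
    using assms unfolding norm_pochhammer shift
    by (intro prod_pos) (auto simp: norm_complex_def add_pos_nonneg)
  moreover have "pochhammer x (n+1) > 0" using assms by (intro pochhammer_pos) auto
  moreover have "norm (exp (Complex x y * of_real (ln (real n)))) = exp (x * ln (real n))" by simp
  ultimately have "norm (Gamma_series (Complex x y) n) / Gamma_series x n =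
      pochhammer x (n+1) / norm (pochhammer (Complex x y) (n+1))"
    unfolding Gamma_series_def norm_divide norm_mult by (simp add: norm_fact field_simps)
  then show ?thesis
    unfolding norm_pochhammer shift by (simp add: pochhammer_prod prod_dividef atLeast0LessThan)
qed

lemma norm_Gamma_divide_Gamma_Re_mono:
  assumes "0 < x" "x \<le> u"
  shows "norm (Gamma (Complex x y)) / Gamma x \<le> norm (Gamma (Complex u y)) / Gamma u"
proof (rule LIMSEQ_le)
  have series: "(\<lambda>n. norm (Gamma_series (Complex v y) n) / Gamma_series v n) \<longlonglongrightarrow>
      norm (Gamma (Complex v y)) / Gamma v"
    if "v > 0" for v :: real
    by (intro tendsto_intros) (use Gamma_real_pos[OF that] in auto)
  show "(\<lambda>n. norm (Gamma_series (Complex x y) n) / Gamma_series x n) \<longlonglongrightarrow>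
      norm (Gamma (Complex x y)) / Gamma x"
    "(\<lambda>n. norm (Gamma_series (Complex u y) n) / Gamma_series u n) \<longlonglongrightarrow>
        norm (Gamma (Complex u y)) / Gamma u"
    using assms by (auto intro: series)
  have "norm (Gamma_series (Complex x y) n) / Gamma_series x n \<le>
      norm (Gamma_series (Complex u y) n) / Gamma_series u n"
    if "n \<ge> 1" for n
    using assms that by (simp only: norm_Gamma_series_divide)
      (intro prod_mono conjI Re_divide_norm_mono, auto)
  then show "\<exists>N. \<forall>n\<ge>N. norm (Gamma_series (Complex x y) n) / Gamma_series x n
      \<le> norm (Gamma_series (Complex u y) n) / Gamma_series u n" by blast
qed

lemma norm_Gamma_half_line_le:
  "norm (Gamma (Complex (1/2) y)) \<le> sqrt (2 * pi) * exp (- (pi / 2) * \<bar>y\<bar>)"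
proof (rule power2_le_imp_le)
  define s where "s = Complex (1/2) y"
  have "1 - s = cnj s" by (simp add: s_def complex_eq_iff)
  have "of_real ((norm (Gamma s))\<^sup>2) = Gamma s * Gamma (1 - s)"
    unfolding \<open>1 - s = cnj s\<close> cnj_Gamma[symmetric] by (rule complex_norm_square)
  also have "\<dots> = of_real pi / sin (of_real pi * s)" by (rule Gamma_reflection_complex)
  finally have "(norm (Gamma s))\<^sup>2 = pi / norm (sin (of_real pi * s))"
    by (metis abs_of_nonneg abs_of_pos norm_divide norm_of_real pi_gt_zero zero_le_power2)
  also have "\<dots> \<le> pi / (1 / 2 * exp (pi * \<bar>y\<bar>))"
    using norm_sin_pi_ge[of s] by (intro frac_le) (auto simp: s_def)
  also have "\<dots> = (sqrt (2 * pi) * exp (- (pi / 2) * \<bar>y\<bar>))\<^sup>2"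
    by (simp add: power_mult_distrib exp_minus field_simps flip: exp_double)
  finally show "(norm (Gamma (Complex (1/2) y)))\<^sup>2 \<le> (sqrt (2 * pi) * exp (- (pi / 2) * \<bar>y\<bar>))\<^sup>2"
    unfolding s_def .
qed simp

lemma strip_growth_pochhammer:
  assumes "\<epsilon> > 0"
  shows "strip_growth a b \<epsilon> (\<lambda>s. pochhammer s n)"
  using assms
proof (induction n arbitrary: \<epsilon>)
  case 0
  then show ?case by (intro strip_growthI[of _ _ _ _ 1]) auto
next
  case (Suc n)
  then have "strip_growth a b (\<epsilon> / 2 + \<epsilon> / 2) (\<lambda>s. pochhammer s n * (s + of_nat n))"
    by (intro strip_growth_mult strip_growth_add_const) auto
  then show ?case by (simp add: pochhammer_Suc)
qed

lemma strip_growth_Gamma_half_integer_line: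
  assumes "- (pi / 2) < \<beta>"
  shows "strip_growth (1/2 + real m) (1/2 + real m) \<beta> Gamma"
proof -
  have "strip_growth (1/2) (1/2) (- (pi / 2)) Gamma"
  proof (rule strip_growthI)
    fix s assume "1/2 \<le> Re s" "Re s \<le> 1/2"
    then have "s = Complex (1/2) (Im s)" by (simp add: complex_eq_iff)
    then show "norm (Gamma s) \<le> sqrt (2 * pi) * exp (- (pi / 2) * \<bar>Im s\<bar>)"
      by (metis norm_Gamma_half_line_le)
  qed
  then have "strip_growth (1/2) (1/2) ((\<beta> + pi / 2) + - (pi / 2)) (\<lambda>s. pochhammer s m * Gamma s)"
    using assms by (intro strip_growth_mult strip_growth_pochhammer) auto
  from strip_growth_shift[OF this, of "real m"]
  have "strip_growth (1/2 + real m) (1/2 + real m) \<beta>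
      (\<lambda>s. pochhammer (s - of_nat m) m * Gamma (s - of_nat m))"
    by simp
  then show ?thesis
  proof (rule strip_growth_cong)
    fix s :: complex assume "Im s \<noteq> 0"
    then have "s - of_nat m \<notin> \<int>\<^sub>\<le>\<^sub>0" using nonpos_Ints_Im_eq_0[of "s - of_nat m"] by auto
    then show "Gamma s = pochhammer (s - of_nat m) m * Gamma (s - of_nat m)"
      using Gamma_add_of_nat[of "s - of_nat m" m] by simp
  qed
qed

lemma norm_Gamma_le_norm_Gamma_add_of_nat:
  assumes "1 \<le> \<bar>Im s\<bar>"
  shows "norm (Gamma s) \<le> norm (Gamma (s + of_nat n))"
proof -
  have "1 \<le> norm (pochhammer s n)"
    unfolding norm_pochhammer
  proof (rule prod_ge_1)
    fix i show "1 \<le> norm (s + of_nat i)"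
      using assms abs_Im_le_cmod[of "s + of_nat i"] by simp
  qed
  moreover have "Gamma (s + of_nat n) = pochhammer s n * Gamma s"
    using assms nonpos_Ints_Im_eq_0[of s] by (intro Gamma_add_of_nat) auto
  ultimately show ?thesis
    using mult_right_mono[of 1 "norm (pochhammer s n)" "norm (Gamma s)"] by (simp add: norm_mult)
qed

lemma strip_growth_Gamma:
  assumes "- (pi / 2) < \<beta>"
  shows "strip_growth a b \<beta> Gamma"
proof -
  define N where "N = nat \<lceil>\<bar>a\<bar> + 1\<rceil>"
  define m where "m = nat \<lceil>\<bar>b\<bar> + real N\<rceil>"
  define u where "u = 1/2 + real m"
  have N: "1/2 \<le> a + real N" and m: "b + real N \<le> u" unfolding N_def m_def u_def by linarith+
  have "u > 0" by (simp add: u_def)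
  obtain Y M where "Y \<ge> 0" "M \<ge> 0" and line:
    "\<And>s. u \<le> Re s \<Longrightarrow> Re s \<le> u \<Longrightarrow> Y \<le> \<bar>Im s\<bar> \<Longrightarrow> norm (Gamma s) \<le> M * exp (\<beta> * \<bar>Im s\<bar>)"
    using strip_growth_Gamma_half_integer_line[OF assms, of m] unfolding u_def
    by (elim strip_growthE) blast
  have "continuous_on {1/2..u} (Gamma :: real \<Rightarrow> real)"
    by (intro continuous_intros) (auto elim!: nonpos_Ints_cases)
  then have "bounded ((Gamma :: real \<Rightarrow> real) ` {1/2..u})"
    by (intro compact_imp_bounded compact_continuous_image) auto
  then obtain K where K: "\<And>x::real. x \<in> {1/2..u} \<Longrightarrow> norm (Gamma x) \<le> K"
    unfolding bounded_iff by blast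
  have "0 \<le> K" using order_trans[OF norm_ge_zero K[of u]] by (simp add: u_def)
  show ?thesis
  proof (rule strip_growthI)
    fix s assume s: "a \<le> Re s" "Re s \<le> b" "max 1 Y \<le> \<bar>Im s\<bar>"
    define x where "x = Re s + real N"
    have x: "x \<in> {1/2..u}" using s N m by (auto simp: x_def)
    have "norm (Gamma s) \<le> norm (Gamma (s + of_nat N))"
      using s by (intro norm_Gamma_le_norm_Gamma_add_of_nat) auto
    also have "s + of_nat N = Complex x (Im s)" by (simp add: x_def complex_eq_iff)
    also have "norm (Gamma (Complex x (Im s))) \<le>
        Gamma x / Gamma u * norm (Gamma (Complex u (Im s)))"
      using norm_Gamma_divide_Gamma_Re_mono[of x u "Im s"] x Gamma_real_pos[of x]
      by (simp add: field_simps)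
    also have "\<dots> \<le> K / Gamma u * (M * exp (\<beta> * \<bar>Im s\<bar>))"
      using K[OF x] x s \<open>0 \<le> K\<close> Gamma_real_pos[of x] Gamma_real_pos[OF \<open>u > 0\<close>]
        line[of "Complex u (Im s)"]
      by (intro mult_mono divide_right_mono) auto
    finally show "norm (Gamma s) \<le> (K / Gamma u * M) * exp (\<beta> * \<bar>Im s\<bar>)" by (simp add: mult.assoc)
  qed
qed

lemma strip_growth_Gamma_mult:
  assumes "strip_growth a b \<alpha> G" "\<alpha> < pi / 2"
  shows "strip_growth a b ((\<alpha> - pi / 2) / 2) (\<lambda>s. Gamma s * G s)"
proof -
  have "strip_growth a b (- (\<alpha> + pi / 2) / 2 + \<alpha>) (\<lambda>s. Gamma s * G s)"
    using assms by (intro strip_growth_mult strip_growth_Gamma) (simp_all add: field_simps)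
  moreover have "- (\<alpha> + pi / 2) / 2 + \<alpha> = (\<alpha> - pi / 2) / 2" by (simp add: field_simps)
  ultimately show ?thesis by (simp only:)
qed

section \<open>Sums over the poles of the Gamma function\<close>

lemma Gamma_holomorphic_on_strip_minus_poles:
  "Gamma holomorphic_on {s. - real N - 1 < Re s} - (\<lambda>n. - of_nat n) ` {..N}"
proof (rule holomorphic_Gamma)
  have "s \<in> (\<lambda>n. - of_nat n) ` {..N}" if s: "- real N - 1 < Re s" "s \<in> \<int>\<^sub>\<le>\<^sub>0" for s :: complex
  proof -
    obtain n where n: "s = - of_nat n" using s(2) by (elim nonpos_Ints_cases')
    then have "n \<le> N" using s(1) by simp
    then show ?thesis using n by auto
  qed
  then show "({s. - real N - 1 < Re s} - (\<lambda>n. - of_nat n) ` {..N}) \<inter> \<int>\<^sub>\<le>\<^sub>0 = {}" by auto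
qed

lemma residue_Gamma_mult:
  assumes "open S" "- of_nat n \<in> S" "W holomorphic_on S"
  shows "residue (\<lambda>s. Gamma s * W s) (- of_nat n) = (-1) ^ n / fact n * W (- of_nat n)"
proof (rule residue_simple')
  let ?T = "S \<inter> - (\<int>\<^sub>\<le>\<^sub>0 - {- of_nat n :: complex})"
  show "open ?T"
    by (intro open_Int assms open_Compl closed_subset_Ints) auto
  show "- of_nat n \<in> ?T" using assms by auto
  show "(\<lambda>s. Gamma s * W s) holomorphic_on ?T - {- of_nat n}"
    using assms(3) by (intro holomorphic_intros) (auto intro: holomorphic_on_subset)
  have "isCont W (- of_nat n)"
    using assms holomorphic_on_imp_continuous_on continuous_on_eq_continuous_at by blast
  then have "((\<lambda>s. (Gamma s * (s + of_nat n)) * W s) \<longlongrightarrow>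
      ((-1) ^ n / fact n) * W (- of_nat n)) (at (- of_nat n))"
    unfolding isCont_def by (intro tendsto_mult Gamma_residues)
  then show "((\<lambda>s. Gamma s * W s * (s - - of_nat n)) \<longlongrightarrow>
      ((-1) ^ n / fact n) * W (- of_nat n)) (at (- of_nat n))"
    by (simp add: mult_ac)
qed

lemma fact_le_prod_half_odd: "fact N / 2 \<le> (\<Prod>k<Suc N. real k + 1/2)"
proof (induction N)
  case (Suc N)
  have "fact (Suc N) / 2 = (fact N / 2) * (real N + 1)" by (simp add: field_simps)
  also have "\<dots> \<le> (\<Prod>k<Suc N. real k + 1/2) * (real (Suc N) + 1/2)"
    by (rule mult_mono[OF Suc]) (auto intro!: prod_nonneg simp del: prod.lessThan_Suc)
  finally show ?case by (simp add: mult.commute)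
qed simp

lemma norm_Gamma_negative_half_line_le:
  "norm (Gamma (Complex (- real N - 1/2) y)) \<le> 2 / fact N * norm (Gamma (Complex (1/2) y))"
proof -
  define s where "s = Complex (- real N - 1/2) y"
  have "s \<notin> \<int>\<^sub>\<le>\<^sub>0"
  proof
    assume "s \<in> \<int>\<^sub>\<le>\<^sub>0"
    then obtain n where "s = - of_nat n" by (elim nonpos_Ints_cases')
    then have "2 * real n = real (2 * N + 1)" by (simp add: s_def complex_eq_iff)
    then have "2 * n = 2 * N + 1" by linarith
    then show False by presburger
  qed
  then have Gamma_shift: "Gamma (Complex (1/2) y) = pochhammer s (Suc N) * Gamma s"
    using Gamma_add_of_nat[of s "Suc N"]
    by (simp add: s_def complex_eq_iff Complex_eq algebra_simps)
  have "fact N / 2 \<le> (\<Prod>k<Suc N. real k + 1/2)" by (rule fact_le_prod_half_odd)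
  also have "\<dots> = (\<Prod>i<Suc N. real (Suc N - Suc i) + 1/2)"
    by (rule prod.nat_diff_reindex[symmetric])
  also have "\<dots> \<le> norm (pochhammer s (Suc N))"
    unfolding norm_pochhammer
  proof (intro prod_mono conjI)
    fix i assume "i \<in> {..<Suc N}"
    then show "real (Suc N - Suc i) + 1/2 \<le> norm (s + of_nat i)"
      using abs_Re_le_cmod[of "s + of_nat i"] by (simp add: s_def of_nat_diff)
  qed auto
  finally have "fact N / 2 * norm (Gamma s) \<le> norm (Gamma (Complex (1/2) y))"
    unfolding Gamma_shift norm_mult by (rule mult_right_mono) simp
  then show ?thesis unfolding s_def[symmetric] by (simp add: field_simps)
qed

context
  fixes W :: "complex \<Rightarrow> complex" and P :: "complex set" and b c \<alpha> \<kappa> R B :: real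
  assumes c: "0 < c" "c < b" and \<alpha>: "\<alpha> < pi / 2" and B: "0 \<le> B"
    and P: "finite P" "\<And>p. p \<in> P \<Longrightarrow> Re p < c" "\<And>p. p \<in> P \<Longrightarrow> p \<notin> \<int>\<^sub>\<le>\<^sub>0"
    and W: "W holomorphic_on {s. Re s < b} - P"
    and bound: "\<And>s. Re s \<le> c \<Longrightarrow> R \<le> norm s \<Longrightarrow> norm (W s) \<le> B * exp (\<alpha> * \<bar>Im s\<bar> - \<kappa> * Re s)"
begin

lemma left_half_plane_strip_growth: "strip_growth a c \<alpha> W"
proof (rule strip_growth_exp_bound[OF B])
  fix s assume "Re s \<le> c" "R \<le> \<bar>Im s\<bar>"
  then show "norm (W s) \<le> B * exp (\<alpha> * \<bar>Im s\<bar> + - \<kappa> * Re s)"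
    using bound[of s] abs_Im_le_cmod[of s] by simp
qed

lemma vertical_residue_sum_Gamma_mult:
  assumes N: "\<And>p. p \<in> P \<Longrightarrow> - real N - 1/2 < Re p"
  shows "vertical_integrable (- real N - 1/2) (\<lambda>s. Gamma s * W s)"
    "vertical_integrable c (\<lambda>s. Gamma s * W s)"
    "vertical_integral c (\<lambda>s. Gamma s * W s)
        - vertical_integral (- real N - 1/2) (\<lambda>s. Gamma s * W s) =
      2 * pi * \<i> * ((\<Sum>n\<le>N. (-1) ^ n / fact n * W (- of_nat n)) +
          (\<Sum>p\<in>P. residue (\<lambda>s. Gamma s * W s) p))"
proof -
  let ?G = "\<lambda>s. Gamma s * W s"
  define Q where "Q = (\<lambda>n. - of_nat n :: complex) ` {..N}"
  have strip: "- real N - 1 < - real N - 1/2" "- real N - 1/2 < c" "c < b" using c by auto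
  have hol: "?G holomorphic_on {s. - real N - 1 < Re s \<and> Re s < b} - (Q \<union> P)"
    using Gamma_holomorphic_on_strip_minus_poles[of N] W unfolding Q_def
    by (auto intro!: holomorphic_on_mult intro: holomorphic_on_subset)
  have poles: "- real N - 1/2 < Re p \<and> Re p < c" if "p \<in> Q \<union> P" for p
    using that P N c by (auto simp: Q_def)
  have fin: "finite (Q \<union> P)" using P(1) by (simp add: Q_def)
  have growth: "strip_growth (- real N - 1/2) c ((\<alpha> - pi / 2) / 2) ?G" "(\<alpha> - pi / 2) / 2 < 0"
    using \<alpha> by (auto intro: strip_growth_Gamma_mult left_half_plane_strip_growth)
  show "vertical_integrable (- real N - 1/2) ?G" "vertical_integrable c ?G"
    by (rule vertical_integrable_strip_edges[OF strip hol fin poles growth]; assumption)+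
  have "residue ?G (- of_nat n) = (-1) ^ n / fact n * W (- of_nat n)" for n
    using P c by (intro residue_Gamma_mult[OF _ _ W])
      (auto intro!: open_Diff finite_imp_closed open_halfspace_Re_lt)
  then have "(\<Sum>p\<in>Q. residue ?G p) = (\<Sum>n\<le>N. (-1) ^ n / fact n * W (- of_nat n))"
    unfolding Q_def by (subst sum.reindex) (auto simp: inj_on_def)
  moreover have "Q \<inter> P = {}" using P(3) by (auto simp: Q_def)
  ultimately have "(\<Sum>p\<in>Q \<union> P. residue ?G p) =
      (\<Sum>n\<le>N. (-1) ^ n / fact n * W (- of_nat n)) + (\<Sum>p\<in>P. residue ?G p)"
    using fin by (simp add: sum.union_disjoint)
  then show "vertical_integral c ?G - vertical_integral (- real N - 1/2) ?G =
      2 * pi * \<i> * ((\<Sum>n\<le>N. (-1) ^ n / fact n * W (- of_nat n)) + (\<Sum>p\<in>P. residue ?G p))"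
    using vertical_residue_theorem[OF strip hol fin poles growth] by simp
qed

lemma eventually_poles_right_of_line: "\<forall>\<^sub>F N in sequentially. \<forall>p\<in>P. - real N - 1/2 < Re p"
proof (intro eventually_ball_finite P(1) ballI)
  fix p
  show "\<forall>\<^sub>F N in sequentially. - real N - 1/2 < Re p"
    using eventually_ge_at_top[of "nat \<lceil>- Re p\<rceil>"] by eventually_elim linarith
qed

lemma vertical_integral_left_lines_tendsto_0:
  "(\<lambda>N. vertical_integral (- real N - 1/2) (\<lambda>s. Gamma s * W s)) \<longlonglongrightarrow> 0"
proof (rule Lim_null_comparison)
  let ?G = "\<lambda>s. Gamma s * W s"
  define D where "D y = 2 * sqrt (2 * pi) * B * exp (\<kappa> / 2) * exp (- (pi / 2 - \<alpha>) * \<bar>y\<bar>)"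
    for y :: real
  have D_integrable: "integrable lborel D"
    unfolding D_def using \<alpha> by (intro integrable_mult_right integrable_exp_minus_abs) simp
  have "\<forall>\<^sub>F N in sequentially. R \<le> real N"
    using eventually_ge_at_top[of "nat \<lceil>R\<rceil>"] by eventually_elim linarith
  with eventually_poles_right_of_line
  show "\<forall>\<^sub>F N in sequentially. norm (vertical_integral (- real N - 1/2) ?G) \<le>
      (LINT y|lborel. D y) * (inverse (fact N) * exp \<kappa> ^ N)"
  proof eventually_elim
    case (elim N)
    have "norm (?G (Complex (- real N - 1/2) y)) \<le> D y * (inverse (fact N) * exp \<kappa> ^ N)" for y
    proof -
      define s where "s = Complex (- real N - 1/2) y"
      have "norm (Gamma s) \<le> 2 / fact N * (sqrt (2 * pi) * exp (- (pi / 2) * \<bar>y\<bar>))"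
        using norm_Gamma_negative_half_line_le[of N y]
          mult_left_mono[OF norm_Gamma_half_line_le[of y], of "2 / fact N"]
        by (simp add: s_def)
      moreover have "norm (W s) \<le> B * exp (\<alpha> * \<bar>Im s\<bar> - \<kappa> * Re s)"
        using elim c abs_Re_le_cmod[of s] by (intro bound) (auto simp: s_def)
      moreover have "\<alpha> * \<bar>Im s\<bar> - \<kappa> * Re s = \<alpha> * \<bar>y\<bar> + (\<kappa> / 2 + real N * \<kappa>)"
        by (simp add: s_def algebra_simps)
      ultimately have "norm (?G s) \<le> (2 / fact N * (sqrt (2 * pi) * exp (- (pi / 2) * \<bar>y\<bar>)))
          * (B * (exp (\<alpha> * \<bar>y\<bar>) * (exp (\<kappa> / 2) * exp \<kappa> ^ N)))"
        unfolding norm_mult by (intro mult_mono) (auto simp: exp_add exp_of_nat_mult)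
      also have "\<dots> = D y * (inverse (fact N) * exp \<kappa> ^ N)"
        by (simp add: D_def field_simps flip: exp_add)
      finally show ?thesis unfolding s_def .
    qed
    then show ?case
      using norm_vertical_integral_le[of "- real N - 1/2" ?G
          "\<lambda>y. D y * (inverse (fact N) * exp \<kappa> ^ N)"]
        vertical_residue_sum_Gamma_mult(1)[of N] elim D_integrable by simp
  qed
  have "(\<lambda>N. inverse (fact N) * exp \<kappa> ^ N) \<longlonglongrightarrow> 0"
    by (rule summable_LIMSEQ_zero[OF summable_exp])
  from tendsto_mult_left[OF this]
  show "(\<lambda>N. (LINT y|lborel. D y) * (inverse (fact N) * exp \<kappa> ^ N)) \<longlonglongrightarrow> 0" by simp
qed

theorem Gamma_residue_sums:
  shows "vertical_integrable c (\<lambda>s. Gamma s * W s)"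
    "(\<lambda>n. (-1) ^ n / fact n * W (- of_nat n)) sums
       (1 / (2 * of_real pi * \<i>) * vertical_integral c (\<lambda>s. Gamma s * W s) -
           (\<Sum>p\<in>P. residue (\<lambda>s. Gamma s * W s) p))"
proof -
  let ?G = "\<lambda>s. Gamma s * W s"
  obtain N where "\<forall>p\<in>P. - real N - 1/2 < Re p"
    using eventually_happens'[OF _ eventually_poles_right_of_line] by auto
  then show "vertical_integrable c ?G" by (intro vertical_residue_sum_Gamma_mult(2)) auto
  let ?lhs = "\<lambda>N. 1 / (2 * of_real pi * \<i>)
      * (vertical_integral c ?G - vertical_integral (- real N - 1/2) ?G)
      - (\<Sum>p\<in>P. residue ?G p)"
  have "?lhs \<longlonglongrightarrow> 1 / (2 * of_real pi * \<i>) * (vertical_integral c ?G - 0) - (\<Sum>p\<in>P. residue ?G p)"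
    by (intro tendsto_intros vertical_integral_left_lines_tendsto_0)
  moreover have "\<forall>\<^sub>F N in sequentially. ?lhs N = (\<Sum>n\<le>N. (-1) ^ n / fact n * W (- of_nat n))"
    using eventually_poles_right_of_line
  proof eventually_elim
    case (elim N)
    then show ?case using vertical_residue_sum_Gamma_mult(3)[of N] by simp
  qed
  ultimately have "(\<lambda>N. \<Sum>n\<le>N. (-1) ^ n / fact n * W (- of_nat n)) \<longlonglongrightarrow>
      1 / (2 * of_real pi * \<i>) * (vertical_integral c ?G - 0) - (\<Sum>p\<in>P. residue ?G p)"
    by (rule Lim_transform_eventually)
  then show "(\<lambda>n. (-1) ^ n / fact n * W (- of_nat n)) sums
      (1 / (2 * of_real pi * \<i>) * vertical_integral c ?G - (\<Sum>p\<in>P. residue ?G p))"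
    by (simp add: sums_def_le)
qed

end

section \<open>The cotangent kernel\<close>

definition cot_kernel :: "complex \<Rightarrow> complex \<Rightarrow> complex" where
  "cot_kernel z \<xi> = cot (of_real pi * (\<xi> - z)) - cot (of_real pi * \<xi>)"

lemma cot_kernel_altdef:
  assumes "\<xi> \<notin> \<int>" "\<xi> - z \<notin> \<int>"
  shows "cot_kernel z \<xi> =
    sin (of_real pi * z) / (sin (of_real pi * \<xi>) * sin (of_real pi * (\<xi> - z)))"
proof -
  let ?a = "of_real pi * \<xi>" and ?b = "of_real pi * (\<xi> - z)"
  have "sin ?a \<noteq> 0" "sin ?b \<noteq> 0" using assms by (simp_all add: sin_pi_eq_0_iff)
  then have "cot_kernel z \<xi> = (sin ?a * cos ?b - cos ?a * sin ?b) / (sin ?a * sin ?b)"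
    by (simp add: cot_kernel_def cot_def divide_simps)
  also have "sin ?a * cos ?b - cos ?a * sin ?b = sin (?a - ?b)" by (simp only: sin_diff)
  also have "?a - ?b = of_real pi * z" by (simp add: algebra_simps)
  finally show ?thesis .
qed

lemma cot_pi_add_Ints:
  fixes w n :: complex
  assumes "n \<in> \<int>"
  shows "cot (of_real pi * (w + n)) = cot (of_real pi * w)"
proof -
  have "sin (of_real pi * n) = 0" using assms by (simp add: sin_pi_eq_0_iff)
  moreover from this have "cos (of_real pi * n) \<noteq> 0"
    using sin_cos_squared_add[of "of_real pi * n"] by auto
  ultimately show ?thesis by (simp add: cot_def distrib_left sin_add cos_add)
qed

lemma cot_kernel_add_Ints: "n \<in> \<int> \<Longrightarrow> cot_kernel (z + n) \<xi> = cot_kernel z \<xi>"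
  using cot_pi_add_Ints[of "- n" "\<xi> - z"] by (simp add: cot_kernel_def algebra_simps)

lemma cot_kernel_Ints: "z \<in> \<int> \<Longrightarrow> cot_kernel z \<xi> = 0"
  using cot_kernel_add_Ints[of z 0 \<xi>] by (simp add: cot_kernel_def)

lemma holomorphic_on_cot_pi:
  assumes "\<And>\<xi>. \<xi> \<in> S \<Longrightarrow> \<xi> - w \<notin> \<int>"
  shows "(\<lambda>\<xi>. cot (of_real pi * (\<xi> - w))) holomorphic_on S"
  using assms unfolding cot_def by (intro holomorphic_intros) (auto simp: sin_pi_eq_0_iff)

lemma residue_mult_cot_pi:
  assumes "open S" "p \<in> S" "f holomorphic_on S" "p - w \<in> \<int>"
  shows "residue (\<lambda>\<xi>. f \<xi> * cot (of_real pi * (\<xi> - w))) p = f p / of_real pi"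
proof -
  have "cot (of_real pi * (\<xi> - w)) = cot (of_real pi * (\<xi> - p))" for \<xi>
    using cot_pi_add_Ints[OF assms(4), of "\<xi> - p"] by simp
  moreover have "residue (\<lambda>\<xi>. f \<xi> * cot (of_real pi * (\<xi> - p))) p = f p / of_real pi"
  proof (rule residue_simple')
    let ?S = "S \<inter> ball p 1"
    show "open ?S" "p \<in> ?S" using assms by auto
    have "\<xi> - p \<notin> \<int>" if "\<xi> \<in> ?S - {p}" for \<xi>
    proof
      assume "\<xi> - p \<in> \<int>"
      then obtain n where n: "\<xi> - p = of_int n" by (rule Ints_cases)
      then have "\<bar>real_of_int n\<bar> < 1" using that by (auto simp: dist_norm norm_minus_commute)
      then have "n = 0" by linarith
      then show False using n that by simp
    qed
    then show "(\<lambda>\<xi>. f \<xi> * cot (of_real pi * (\<xi> - p))) holomorphic_on ?S - {p}"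
      using assms(3) by (intro holomorphic_on_mult holomorphic_on_cot_pi)
        (auto intro: holomorphic_on_subset)
    have "((\<lambda>\<xi>. sin (of_real pi * (\<xi> - p))) has_field_derivative of_real pi) (at p)"
      by (auto intro!: derivative_eq_intros)
    then have "((\<lambda>\<xi>. sin (of_real pi * (\<xi> - p)) / (\<xi> - p)) \<longlongrightarrow> of_real pi) (at p)"
      by (simp add: has_field_derivative_iff)
    moreover have "(f \<longlongrightarrow> f p) (at p)"
      using holomorphic_on_imp_continuous_on[OF assms(3)] assms(1,2)
      by (simp add: continuous_on_eq_continuous_at isCont_def)
    moreover have "((\<lambda>\<xi>. cos (of_real pi * (\<xi> - p))) \<longlongrightarrow> cos (of_real pi * (p - p))) (at p)"
      by (intro tendsto_intros)
    ultimately have "((\<lambda>\<xi>. f \<xi> * cos (of_real pi * (\<xi> - p)) /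
          (sin (of_real pi * (\<xi> - p)) / (\<xi> - p)))
        \<longlongrightarrow> f p * cos (of_real pi * (p - p)) / of_real pi) (at p)"
      by (intro tendsto_divide tendsto_mult) auto
    then show "((\<lambda>\<xi>. f \<xi> * cot (of_real pi * (\<xi> - p)) * (\<xi> - p)) \<longlongrightarrow> f p / of_real pi) (at p)"
      by (simp add: cot_def)
  qed
  ultimately show ?thesis by simp
qed

lemma residue_mult_cot_kernel:
  assumes "open S" "p \<in> S" "f holomorphic_on S"
  shows "residue (\<lambda>\<xi>. f \<xi> * cot_kernel z \<xi>) p =
    ((if p - z \<in> \<int> then f p else 0) - (if p \<in> \<int> then f p else 0)) / of_real pi"
proof -
  let ?h = "\<lambda>w \<xi>. f \<xi> * cot (of_real pi * (\<xi> - w))"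
  have residue_h: "residue (?h w) p = (if p - w \<in> \<int> then f p else 0) / of_real pi" for w
  proof (cases "p - w \<in> \<int>")
    case True
    then show ?thesis using residue_mult_cot_pi[OF assms] by simp
  next
    case False
    have "open (S \<inter> (\<lambda>\<xi>. \<xi> - w) -` (- \<int>))"
      by (intro open_Int open_vimage open_Compl closed_Ints assms(1) continuous_intros)
    then have "residue (?h w) p = 0"
    proof (rule residue_holo)
      show "p \<in> S \<inter> (\<lambda>\<xi>. \<xi> - w) -` (- \<int>)" using False assms(2) by simp
      show "?h w holomorphic_on S \<inter> (\<lambda>\<xi>. \<xi> - w) -` (- \<int>)"
        using assms(3) by (intro holomorphic_on_mult holomorphic_on_cot_pi)
          (auto intro: holomorphic_on_subset)
    qed
    then show ?thesis using False by simp
  qed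
  define U where "U = S \<inter> (\<lambda>\<xi>. \<xi> - z) -` (- (\<int> - {p - z})) \<inter> - (\<int> - {p})"
  have "open U" unfolding U_def
    by (intro open_Int open_vimage open_Compl closed_subset_Ints assms(1) continuous_intros) auto
  have "p \<in> U" using assms(2) by (simp add: U_def)
  have h_U: "?h w holomorphic_on U - {p}" if "w = z \<or> w = 0" for w
    using that assms(3) by (intro holomorphic_on_mult holomorphic_on_cot_pi)
      (auto simp: U_def intro: holomorphic_on_subset)
  have "(\<lambda>\<xi>. f \<xi> * cot_kernel z \<xi>) = (\<lambda>\<xi>. ?h z \<xi> - ?h 0 \<xi>)"
    by (simp add: cot_kernel_def right_diff_distrib)
  moreover have "residue (\<lambda>\<xi>. ?h z \<xi> - ?h 0 \<xi>) p = residue (?h z) p - residue (?h 0) p"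
    using \<open>open U\<close> \<open>p \<in> U\<close> by (rule residue_diff) (use h_U in blast)+
  ultimately show ?thesis
    using residue_h[of z] residue_h[of 0] by (simp only: diff_divide_distrib diff_zero)
qed

section \<open>Integer translates of a point\<close>

lemma Re_Ints: "w \<in> \<int> \<Longrightarrow> Re w \<in> \<int>"
  by (auto elim!: Ints_cases)

lemma real_unit_interval_not_Ints: "0 < x \<Longrightarrow> x < 1 \<Longrightarrow> (x :: real) \<notin> \<int>"
  by (auto elim!: Ints_cases)

definition int_translates :: "real \<Rightarrow> real \<Rightarrow> complex \<Rightarrow> complex set" where
  "int_translates l u w = {\<xi>. l < Re \<xi> \<and> Re \<xi> < u \<and> \<xi> - w \<in> \<int>}"

lemma finite_int_translates: "finite (int_translates l u w)"
proof (rule finite_subset)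
  show "int_translates l u w \<subseteq> (\<lambda>n. w + of_int n) ` {\<lfloor>l - Re w\<rfloor>..\<lceil>u - Re w\<rceil>}"
  proof
    fix \<xi> assume \<xi>: "\<xi> \<in> int_translates l u w"
    then obtain n where "\<xi> - w = of_int n" by (auto simp: int_translates_def elim: Ints_cases)
    then have n: "\<xi> = w + of_int n" by (simp add: algebra_simps)
    then have "n \<in> {\<lfloor>l - Re w\<rfloor>..\<lceil>u - Re w\<rceil>}"
      using \<xi> by (auto simp: int_translates_def) linarith+
    then show "\<xi> \<in> (\<lambda>n. w + of_int n) ` {\<lfloor>l - Re w\<rfloor>..\<lceil>u - Re w\<rceil>}" using n by blast
  qed
qed simp

lemma sum_int_translates_split:
  assumes "l < m" "m < u" "m - Re w \<notin> \<int>"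
  shows "(\<Sum>\<xi>\<in>int_translates l u w. g \<xi>) =
      (\<Sum>\<xi>\<in>int_translates l m w. g \<xi>) + (\<Sum>\<xi>\<in>int_translates m u w. g \<xi>)"
proof -
  have "Re \<xi> \<noteq> m" if "\<xi> - w \<in> \<int>" for \<xi>
    using Re_Ints[OF that] assms(3) by auto
  then have "int_translates l u w = int_translates l m w \<union> int_translates m u w"
    using assms(1,2) by (force simp: int_translates_def)
  then show ?thesis
    by (simp only:) (rule sum.union_disjoint, auto simp: finite_int_translates,
        auto simp: int_translates_def)
qed

lemma int_translates_unit_strip:
  assumes "l < Re w" "Re w < u" "u \<le> Re w + 1" "Re w - 1 \<le> l"
  shows "int_translates l u w = {w}"
proof -
  have "\<xi> = w" if \<xi>: "l < Re \<xi>" "Re \<xi> < u" "\<xi> - w \<in> \<int>" for \<xi>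
  proof -
    obtain n where n: "\<xi> - w = of_int n" using \<xi>(3) by (rule Ints_cases)
    then have "Re \<xi> - Re w = of_int n" by (simp add: complex_eq_iff)
    then have "\<bar>real_of_int n\<bar> < 1" using \<xi> assms by auto
    then have "n = 0" by linarith
    then show ?thesis using n by simp
  qed
  then show ?thesis using assms by (auto simp: int_translates_def)
qed

lemma int_translates_empty:
  assumes "Re w \<le> l" "u \<le> Re w + 1"
  shows "int_translates l u w = {}"
proof -
  have "\<xi> - w \<notin> \<int>" if "l < Re \<xi>" "Re \<xi> < u" for \<xi>
    using that assms Re_Ints[of "\<xi> - w"] real_unit_interval_not_Ints[of "Re \<xi> - Re w"] by auto
  then show ?thesis by (auto simp: int_translates_def)
qed

lemma int_translates_0_eq_of_nat:
  assumes "real n < c" "c < real n + 1"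
  shows "int_translates 0 c 0 = of_nat ` {1..n}"
proof
  show "int_translates 0 c 0 \<subseteq> of_nat ` {1..n}"
  proof
    fix \<xi> assume "\<xi> \<in> int_translates 0 c 0"
    then obtain k where k: "\<xi> = of_int k" "0 < real_of_int k" "real_of_int k < c"
      by (auto simp: int_translates_def elim: Ints_cases)
    then have "nat k \<in> {1..n}" "\<xi> = of_nat (nat k)" using assms by auto
    then show "\<xi> \<in> of_nat ` {1..n}" by blast
  qed
qed (use assms in \<open>auto simp: int_translates_def\<close>)

lemma ex_not_Ints_between:
  fixes l u :: real
  assumes "l < u"
  obtains c where "l < c" "c < u" "c \<notin> \<int>"
proof -
  have "countable (\<int> :: real set)" by (simp add: Ints_def)
  then show ?thesis
    using real_interval_avoid_countable_set[OF assms, of \<int>] that by auto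
qed

lemma Ints_free_neighbourhood:
  fixes c x :: real
  assumes "c > 0" "c \<notin> \<int>" "c - x \<notin> \<int>"
  obtains e where "e > 0" "\<And>t. \<bar>t - c\<bar> < e \<Longrightarrow> t > 0 \<and> t \<notin> \<int> \<and> t - x \<notin> \<int>"
proof -
  have "open ({0<..} \<inter> (- \<int>) \<inter> (\<lambda>t. t - x) -` (- \<int>))"
    by (intro open_Int open_vimage open_Compl closed_Ints open_greaterThan continuous_intros)
  then obtain e where "e > 0" "ball c e \<subseteq> {0<..} \<inter> (- \<int>) \<inter> (\<lambda>t. t - x) -` (- \<int>)"
    using assms unfolding open_contains_ball by blast
  then show ?thesis by (intro that[of e]) (auto simp: subset_iff dist_real_def abs_minus_commute)
qed

section \<open>The interpolated partial sums\<close>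

locale exp_type =
  fixes f :: "complex \<Rightarrow> complex" and \<alpha> \<rho> C :: real
  assumes f_holomorphic: "f holomorphic_on {z. Re z > 0}"
    and \<alpha>: "0 < \<alpha>" "\<alpha> < pi / 2" and \<rho>: "0 \<le> \<rho>" and C: "0 < C"
    and f_bound: "\<And>z. Re z > 0 \<Longrightarrow> norm (f z) \<le> C * exp (\<alpha> * \<bar>Im z\<bar> + \<rho> * Re z)"
begin

definition line_sum :: "real \<Rightarrow> complex \<Rightarrow> complex" where
  "line_sum c z = (\<Sum>\<xi>\<in>int_translates 0 c 0. f \<xi>) +
     1 / (2 * \<i>) * vertical_integral c (\<lambda>\<xi>. f \<xi> * cot_kernel z \<xi>)"

definition admissible :: "real \<Rightarrow> complex \<Rightarrow> bool" where
  "admissible c z \<longleftrightarrow> c > 0 \<and> c \<notin> \<int> \<and> c - 1 < Re z \<and> Re z < c"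

lemma norm_f_cot_kernel_le:
  assumes \<xi>: "Re \<xi> > 0" and \<mu>: "\<mu> > 0" "\<mu> * exp (pi * \<bar>Im \<xi>\<bar>) \<le> norm (sin (of_real pi * \<xi>))"
    and \<nu>: "\<nu> > 0" "\<nu> * exp (pi * \<bar>Im \<xi> - Im z\<bar>) \<le> norm (sin (of_real pi * (\<xi> - z)))"
  shows "norm (f \<xi> * cot_kernel z \<xi>)
    \<le> C * exp (\<rho> * Re \<xi>) / (\<mu> * \<nu>) * exp (\<alpha> * \<bar>Im z\<bar>) * exp (- \<alpha> * \<bar>Im \<xi> - Im z\<bar>)"
proof -
  let ?a = "\<bar>Im z\<bar>" and ?b = "\<bar>Im \<xi>\<bar>" and ?d = "\<bar>Im \<xi> - Im z\<bar>"
  have "0 < norm (sin (of_real pi * \<xi>))"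
    using \<mu>(1) by (intro less_le_trans[OF _ \<mu>(2)]) simp
  moreover have "0 < norm (sin (of_real pi * (\<xi> - z)))"
    using \<nu>(1) by (intro less_le_trans[OF _ \<nu>(2)]) simp
  ultimately have "norm (cot_kernel z \<xi>) =
      norm (sin (of_real pi * z)) /
        (norm (sin (of_real pi * \<xi>)) * norm (sin (of_real pi * (\<xi> - z))))"
    by (subst cot_kernel_altdef) (auto simp: sin_pi_eq_0_iff norm_divide norm_mult)
  also have "\<dots> \<le> exp (pi * ?a) / ((\<mu> * exp (pi * ?b)) * (\<nu> * exp (pi * ?d)))"
    using \<mu> \<nu> by (intro frac_le mult_mono norm_sin_pi_le) auto
  also have "\<dots> = 1 / (\<mu> * \<nu>) * exp (pi * (?a - ?b - ?d))"
    by (simp add: exp_diff right_diff_distrib)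
  finally have "norm (f \<xi> * cot_kernel z \<xi>) \<le>
      (C * exp (\<alpha> * ?b + \<rho> * Re \<xi>)) * (1 / (\<mu> * \<nu>) * exp (pi * (?a - ?b - ?d)))"
    unfolding norm_mult using C by (intro mult_mono f_bound \<xi>) auto
  also have "\<dots> = C * exp (\<rho> * Re \<xi>) / (\<mu> * \<nu>) * exp (\<alpha> * ?b + pi * (?a - ?b - ?d))"
    by (simp add: exp_add)
  also have "\<dots> \<le> C * exp (\<rho> * Re \<xi>) / (\<mu> * \<nu>) * exp (\<alpha> * ?a + - \<alpha> * ?d)"
  proof (intro mult_left_mono)
    have "(pi - \<alpha>) * (?a - ?b - ?d) \<le> 0"
      using \<alpha> by (intro mult_nonneg_nonpos) auto
    then show "exp (\<alpha> * ?b + pi * (?a - ?b - ?d)) \<le> exp (\<alpha> * ?a + - \<alpha> * ?d)"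
      by (simp add: algebra_simps)
  qed (use C \<mu>(1) \<nu>(1) in auto)
  finally show ?thesis unfolding exp_add by (simp only: mult.assoc)
qed

lemma exp_recentre_le:
  "exp (\<alpha> * \<bar>b\<bar>) * exp (- \<alpha> * \<bar>a - b\<bar>) \<le> exp (2 * \<alpha> * \<bar>b\<bar>) * exp (- \<alpha> * \<bar>a::real\<bar>)"
proof -
  have "\<alpha> * \<bar>a\<bar> \<le> \<alpha> * (\<bar>a - b\<bar> + \<bar>b\<bar>)" using \<alpha> by (intro mult_left_mono) auto
  then show ?thesis unfolding exp_add[symmetric] by (simp add: algebra_simps)
qed

lemma strip_growth_f_cot_kernel:
  assumes "0 < a"
  shows "strip_growth a b (- \<alpha>) (\<lambda>\<xi>. f \<xi> * cot_kernel z \<xi>)"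
proof (rule strip_growthI)
  fix s assume s: "a \<le> Re s" "Re s \<le> b" "\<bar>Im z\<bar> + 1 \<le> \<bar>Im s\<bar>"
  have "norm (f s * cot_kernel z s) \<le>
      C * exp (\<rho> * Re s) / (1/4 * (1/4)) * exp (\<alpha> * \<bar>Im z\<bar>) * exp (- \<alpha> * \<bar>Im s - Im z\<bar>)"
  proof (rule norm_f_cot_kernel_le)
    show "1/4 * exp (pi * \<bar>Im s\<bar>) \<le> norm (sin (of_real pi * s))"
      using s by (intro norm_sin_pi_ge_away_from_real_axis) auto
    show "1/4 * exp (pi * \<bar>Im s - Im z\<bar>) \<le> norm (sin (of_real pi * (s - z)))"
      using norm_sin_pi_ge_away_from_real_axis[of "s - z"] s by simp
  qed (use s assms in auto)
  also have "\<dots> \<le> C * exp (\<rho> * Re s) / (1/4 * (1/4)) * (exp (2 * \<alpha> * \<bar>Im z\<bar>) * exp (- \<alpha> * \<bar>Im s\<bar>))"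
    unfolding mult.assoc[of _ "exp _" "exp _"] using C exp_recentre_le
    by (intro mult_left_mono) auto
  also have "\<dots> \<le> C * exp (\<rho> * b) / (1/4 * (1/4)) * (exp (2 * \<alpha> * \<bar>Im z\<bar>) * exp (- \<alpha> * \<bar>Im s\<bar>))"
    using s C \<rho> by (intro mult_right_mono divide_right_mono mult_left_mono)
      (auto intro: mult_left_mono)
  finally show "norm (f s * cot_kernel z s) \<le>
      (C * exp (\<rho> * b) / (1/4 * (1/4)) * exp (2 * \<alpha> * \<bar>Im z\<bar>)) * exp (- \<alpha> * \<bar>Im s\<bar>)"
    by (simp only: mult.assoc)
qed

definition line_const :: "real \<Rightarrow> real \<Rightarrow> real" where
  "line_const c r = 4 * C * exp (\<rho> * c) / (\<bar>sin (pi * c)\<bar> * sin (pi * r))"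

lemma line_const_nonneg: "0 \<le> r \<Longrightarrow> r \<le> 1 \<Longrightarrow> 0 \<le> line_const c r"
  unfolding line_const_def using C
  by (intro divide_nonneg_nonneg mult_nonneg_nonneg sin_ge_zero) auto

lemma norm_f_cot_kernel_line_le:
  assumes "c > 0" "c \<notin> \<int>" "0 < r" "r \<le> c - Re z" "c - Re z \<le> 1 - r"
  shows "norm (f (Complex c y) * cot_kernel z (Complex c y))
    \<le> line_const c r * exp (\<alpha> * \<bar>Im z\<bar>) * exp (- \<alpha> * \<bar>y - Im z\<bar>)"
proof -
  have "sin (pi * r) > 0" using assms by (intro sin_gt_zero) auto
  have "sin (of_real (pi * c) :: complex) \<noteq> 0"
    using sin_pi_eq_0_iff[of "of_real c"] Re_Ints[of "of_real c"] assms(2) by auto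
  then have "sin (pi * c) \<noteq> 0" by (metis sin_of_real of_real_0)
  have "norm (f (Complex c y) * cot_kernel z (Complex c y))
    \<le> C * exp (\<rho> * Re (Complex c y)) / ((\<bar>sin (pi * c)\<bar> / 2) * (sin (pi * r) / 2))
      * exp (\<alpha> * \<bar>Im z\<bar>) * exp (- \<alpha> * \<bar>Im (Complex c y) - Im z\<bar>)"
  proof (rule norm_f_cot_kernel_le)
    show "\<bar>sin (pi * c)\<bar> / 2 * exp (pi * \<bar>Im (Complex c y)\<bar>) \<le>
        norm (sin (of_real pi * Complex c y))"
      using norm_sin_pi_ge[of "Complex c y"] by simp
    have "sin (pi * r) \<le> \<bar>sin (pi * (c - Re z))\<bar>"
      using sin_pi_mono_toward_half[of r "c - Re z"] assms by auto
    then have "sin (pi * r) / 2 * exp (pi * \<bar>y - Im z\<bar>) \<le>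
        \<bar>sin (pi * (c - Re z))\<bar> / 2 * exp (pi * \<bar>y - Im z\<bar>)"
      by (intro mult_right_mono) auto
    also have "\<dots> \<le> norm (sin (of_real pi * (Complex c y - z)))"
      using norm_sin_pi_ge[of "Complex c y - z"] by simp
    finally show "sin (pi * r) / 2 * exp (pi * \<bar>Im (Complex c y) - Im z\<bar>) \<le>
        norm (sin (of_real pi * (Complex c y - z)))" by simp
  qed (use assms \<open>sin (pi * r) > 0\<close> \<open>sin (pi * c) \<noteq> 0\<close> in auto)
  then show ?thesis by (simp add: line_const_def field_simps)
qed

lemma admissible_not_Ints:
  assumes "admissible c z" "Re \<xi> = c"
  shows "\<xi> \<notin> \<int>" "\<xi> - z \<notin> \<int>"
  using assms Re_Ints[of \<xi>] Re_Ints[of "\<xi> - z"] real_unit_interval_not_Ints[of "c - Re z"]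
  by (auto simp: admissible_def)

lemma continuous_on_admissible_line:
  assumes "admissible c z"
  shows "continuous_on {\<xi>. Re \<xi> = c} (\<lambda>\<xi>. f \<xi> * cot_kernel z \<xi>)"
proof -
  have "continuous_on {\<xi>. Re \<xi> = c} f"
    using assms by (intro continuous_on_subset[OF
        holomorphic_on_imp_continuous_on[OF f_holomorphic]])
      (auto simp: admissible_def)
  then show ?thesis
    unfolding cot_kernel_def cot_def using admissible_not_Ints[OF assms]
    by (intro continuous_intros) (auto simp: sin_pi_eq_0_iff)
qed

lemma vertical_integrable_admissible:
  assumes "admissible c z"
  shows "vertical_integrable c (\<lambda>\<xi>. f \<xi> * cot_kernel z \<xi>)"
  using assms \<alpha>(1)
  by (intro vertical_integrable_strip_growth[OF strip_growth_f_cot_kernel _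
      continuous_on_admissible_line])
     (auto simp: admissible_def)

lemma f_cot_kernel_locally_dominated:
  assumes "admissible c z"
  obtains r b where "r > 0" "cball z r \<subseteq> {z. c - 1 < Re z \<and> Re z < c}" "integrable lborel b"
    "\<And>w y. w \<in> cball z r \<Longrightarrow> norm (f (Complex c y) * cot_kernel w (Complex c y)) \<le> b y"
proof -
  define r where "r = min (c - Re z) (Re z - (c - 1)) / 2"
  have c: "c > 0" "c \<notin> \<int>" using assms by (auto simp: admissible_def)
  have r: "r > 0" "r \<le> 1" "2 * r \<le> c - Re z" "2 * r \<le> Re z - (c - 1)"
    using assms by (auto simp: r_def min_def admissible_def)
  have near: "\<bar>Re w - Re z\<bar> \<le> r" "\<bar>Im w\<bar> \<le> \<bar>Im z\<bar> + r" if "w \<in> cball z r" for w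
    using abs_Re_le_cmod[of "w - z"] abs_Im_le_cmod[of "w - z"] that
    by (auto simp: dist_norm norm_minus_commute)
  define A where "A = line_const c r * exp (2 * \<alpha> * (\<bar>Im z\<bar> + r))"
  show ?thesis
  proof (rule that[of r "\<lambda>y. A * exp (- \<alpha> * \<bar>y\<bar>)"])
    show "cball z r \<subseteq> {z. c - 1 < Re z \<and> Re z < c}"
    proof
      fix w assume "w \<in> cball z r"
      from near(1)[OF this] show "w \<in> {z. c - 1 < Re z \<and> Re z < c}" using r by auto
    qed
    show "integrable lborel (\<lambda>y. A * exp (- \<alpha> * \<bar>y\<bar>))"
      by (intro integrable_mult_right integrable_exp_minus_abs \<alpha>)
    fix w y assume w: "w \<in> cball z r"
    have "norm (f (Complex c y) * cot_kernel w (Complex c y))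
        \<le> line_const c r * (exp (\<alpha> * \<bar>Im w\<bar>) * exp (- \<alpha> * \<bar>y - Im w\<bar>))"
      using norm_f_cot_kernel_line_le[of c r w y] near(1)[OF w] r c by (auto simp: mult.assoc)
    also have "\<dots> \<le> line_const c r * (exp (2 * \<alpha> * \<bar>Im w\<bar>) * exp (- \<alpha> * \<bar>y\<bar>))"
      using exp_recentre_le line_const_nonneg r by (intro mult_left_mono) auto
    also have "\<dots> \<le> line_const c r * (exp (2 * \<alpha> * (\<bar>Im z\<bar> + r)) * exp (- \<alpha> * \<bar>y\<bar>))"
      using near(2)[OF w] line_const_nonneg r \<alpha> by (intro mult_left_mono mult_right_mono) auto
    finally show "norm (f (Complex c y) * cot_kernel w (Complex c y)) \<le> A * exp (- \<alpha> * \<bar>y\<bar>)"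
      by (simp add: A_def mult.assoc)
  qed (use r in auto)
qed

lemma line_sum_holomorphic:
  assumes c: "c > 0" "c \<notin> \<int>"
  shows "line_sum c holomorphic_on {z. c - 1 < Re z \<and> Re z < c}"
proof -
  let ?S = "{z. c - 1 < Re z \<and> Re z < c}"
  have admissible: "admissible c z" if "z \<in> ?S" for z using that c by (auto simp: admissible_def)
  have "(\<lambda>z. LINT y|lborel. f (Complex c y) * cot_kernel z (Complex c y)) holomorphic_on ?S"
  proof (rule holomorphic_on_integral_dominated[OF open_vertical_strip])
    fix y
    have "sin (of_real pi * (Complex c y - z)) \<noteq> 0" if "z \<in> ?S" for z
      using admissible_not_Ints(2)[OF admissible[OF that], of "Complex c y"]
      by (simp add: sin_pi_eq_0_iff)
    then show "(\<lambda>z. f (Complex c y) * cot_kernel z (Complex c y)) holomorphic_on ?S"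
      unfolding cot_kernel_def cot_def by (intro holomorphic_intros) auto
  next
    fix z assume z: "z \<in> ?S"
    have "vertical_integrable c (\<lambda>\<xi>. f \<xi> * cot_kernel z \<xi>)"
      using admissible[OF z] by (rule vertical_integrable_admissible)
    then show "(\<lambda>y. f (Complex c y) * cot_kernel z (Complex c y)) \<in> borel_measurable lborel"
      by (auto simp: vertical_integrable_def)
    show "\<exists>r>0. \<exists>b. cball z r \<subseteq> ?S \<and> integrable lborel b \<and>
        (\<forall>w\<in>cball z r. \<forall>y. norm (f (Complex c y) * cot_kernel w (Complex c y)) \<le> b y)"
      using f_cot_kernel_locally_dominated[OF admissible[OF z]] by metis
  qed
  then show ?thesis
    unfolding line_sum_def vertical_integral_def by (intro holomorphic_intros)
qed

context
  fixes c c' :: real and z :: complex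
  assumes c: "0 < c" "c < c'"
    and not_Ints: "c \<notin> \<int>" "c' \<notin> \<int>" "c - Re z \<notin> \<int>" "c' - Re z \<notin> \<int>"
begin

lemma f_cot_kernel_holomorphic_near_strip:
  obtains a b where "0 < a" "a < c" "c' < b"
    "(\<lambda>\<xi>. f \<xi> * cot_kernel z \<xi>) holomorphic_on
       {\<xi>. a < Re \<xi> \<and> Re \<xi> < b} - (int_translates c c' z \<union> int_translates c c' 0)"
proof -
  obtain e where e: "e > 0" "\<And>t. \<bar>t - c\<bar> < e \<Longrightarrow> t > 0 \<and> t \<notin> \<int> \<and> t - Re z \<notin> \<int>"
    using Ints_free_neighbourhood[OF c(1) not_Ints(1,3)] by blast
  obtain e' where e': "e' > 0" "\<And>t. \<bar>t - c'\<bar> < e' \<Longrightarrow> t > 0 \<and> t \<notin> \<int> \<and> t - Re z \<notin> \<int>"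
    using Ints_free_neighbourhood[of c' "Re z"] c not_Ints(2,4) by (metis less_trans)
  define S where "S = {\<xi>. c - e / 2 < Re \<xi> \<and> Re \<xi> < c' + e' / 2}"
  have left_edge: "0 < c - e / 2" using e(1) e(2)[of "c - e / 2"] by auto
  have poles_in_strip: "\<xi> \<in> int_translates c c' w" if "\<xi> \<in> S" "\<xi> - w \<in> \<int>" "w = 0 \<or> w = z" for \<xi> w
  proof -
    have "\<not> \<bar>Re \<xi> - c\<bar> < e" "\<not> \<bar>Re \<xi> - c'\<bar> < e'"
      using e(2)[of "Re \<xi>"] e'(2)[of "Re \<xi>"] Re_Ints[OF that(2)] that(3) by auto
    then show ?thesis using that e(1) e'(1) by (auto simp: int_translates_def S_def)
  qed
  have "f holomorphic_on S"
    using f_holomorphic left_edge by (auto simp: S_def intro: holomorphic_on_subset)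
  moreover have "(\<lambda>\<xi>. cot (of_real pi * (\<xi> - w))) holomorphic_on S - int_translates c c' w"
    if "w = 0 \<or> w = z" for w
    using poles_in_strip that by (intro holomorphic_on_cot_pi) auto
  from this[of 0] this[of z]
  have "cot_kernel z holomorphic_on S - (int_translates c c' z \<union> int_translates c c' 0)"
    unfolding cot_kernel_def by (auto intro!: holomorphic_on_diff intro: holomorphic_on_subset)
  ultimately show ?thesis
    using left_edge e(1) e'(1) unfolding S_def
    by (intro that[of "c - e / 2" "c' + e' / 2"] holomorphic_on_mult)
      (auto intro: holomorphic_on_subset)
qed

lemma vertical_integral_f_cot_kernel_diff:
  "vertical_integral c' (\<lambda>\<xi>. f \<xi> * cot_kernel z \<xi>)
      - vertical_integral c (\<lambda>\<xi>. f \<xi> * cot_kernel z \<xi>) =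
    2 * \<i> * ((\<Sum>\<xi>\<in>int_translates c c' z. f \<xi>) - (\<Sum>\<xi>\<in>int_translates c c' 0. f \<xi>))"
proof -
  let ?G = "\<lambda>\<xi>. f \<xi> * cot_kernel z \<xi>"
  define P where "P = int_translates c c' z \<union> int_translates c c' 0"
  obtain a b where ab: "0 < a" "a < c" "c' < b" "?G holomorphic_on {\<xi>. a < Re \<xi> \<and> Re \<xi> < b} - P"
    unfolding P_def by (rule f_cot_kernel_holomorphic_near_strip)
  have fin: "finite P" by (simp add: P_def finite_int_translates)
  have P_strip: "c < Re p \<and> Re p < c'" if "p \<in> P" for p
    using that by (auto simp: P_def int_translates_def)
  have "vertical_integral c' ?G - vertical_integral c ?G = 2 * pi * \<i> * (\<Sum>p\<in>P. residue ?G p)"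
    using ab c \<alpha>(1) P_strip
    by (intro vertical_residue_theorem[OF _ _ _ ab(4) fin _ strip_growth_f_cot_kernel]) auto
  also have "(\<Sum>p\<in>P. residue ?G p) =
      (\<Sum>p\<in>P. ((if p - z \<in> \<int> then f p else 0) - (if p \<in> \<int> then f p else 0)) / of_real pi)"
    using P_strip c(1)
    by (intro sum.cong refl residue_mult_cot_kernel[OF open_halfspace_Re_gt _ f_holomorphic]) force
  also have "\<dots> = ((\<Sum>p\<in>{p \<in> P. p - z \<in> \<int>}. f p) - (\<Sum>p\<in>{p \<in> P. p \<in> \<int>}. f p)) / of_real pi"
    by (simp add: sum_subtractf sum.inter_filter[OF fin] flip: sum_divide_distrib)
  also have "{p \<in> P. p - z \<in> \<int>} = int_translates c c' z" by (auto simp: P_def int_translates_def)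
  also have "{p \<in> P. p \<in> \<int>} = int_translates c c' 0" by (auto simp: P_def int_translates_def)
  finally show ?thesis by simp
qed

lemma line_sum_diff: "line_sum c' z - line_sum c z = (\<Sum>\<xi>\<in>int_translates c c' z. f \<xi>)"
proof -
  have "vertical_integral c' (\<lambda>\<xi>. f \<xi> * cot_kernel z \<xi>) =
      vertical_integral c (\<lambda>\<xi>. f \<xi> * cot_kernel z \<xi>) +
      2 * \<i> * ((\<Sum>\<xi>\<in>int_translates c c' z. f \<xi>) - (\<Sum>\<xi>\<in>int_translates c c' 0. f \<xi>))"
    using vertical_integral_f_cot_kernel_diff by (simp add: diff_eq_eq add.commute)
  moreover have "(\<Sum>\<xi>\<in>int_translates 0 c' 0. f \<xi>) =
      (\<Sum>\<xi>\<in>int_translates 0 c 0. f \<xi>) + (\<Sum>\<xi>\<in>int_translates c c' 0. f \<xi>)"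
    using c not_Ints(1) by (intro sum_int_translates_split) auto
  ultimately show ?thesis by (simp add: line_sum_def field_simps)
qed

end

definition psum :: "complex \<Rightarrow> complex" where
  "psum z = line_sum (SOME c. admissible c z) z"

lemma line_sum_eq_if_less:
  assumes "admissible c z" "admissible c' z" "c < c'"
  shows "line_sum c z = line_sum c' z"
proof -
  have "line_sum c' z - line_sum c z = (\<Sum>\<xi>\<in>int_translates c c' z. f \<xi>)"
    using assms admissible_not_Ints[of c z "of_real c"] real_unit_interval_not_Ints[of "c - Re z"]
      real_unit_interval_not_Ints[of "c' - Re z"]
    by (intro line_sum_diff) (auto simp: admissible_def)
  also have "int_translates c c' z = {}"
    using assms by (intro int_translates_empty) (auto simp: admissible_def)
  finally show ?thesis by simp
qed

lemma psum_eq_line_sum: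
  assumes "admissible c z"
  shows "psum z = line_sum c z"
proof -
  define c' where "c' = (SOME c. admissible c z)"
  have "admissible c' z" unfolding c'_def using assms by (rule someI)
  then show ?thesis
    using line_sum_eq_if_less[of c' z c] line_sum_eq_if_less[of c z c'] assms
    by (cases c c' rule: linorder_cases) (auto simp: psum_def c'_def[symmetric])
qed

lemma ex_admissible:
  assumes "Re z > -1"
  obtains c where "admissible c z"
proof -
  have "max 0 (Re z) < Re z + 1" using assms by simp
  then obtain c where "max 0 (Re z) < c" "c < Re z + 1" "c \<notin> \<int>" by (rule ex_not_Ints_between)
  then show ?thesis by (intro that[of c]) (auto simp: admissible_def)
qed

lemma psum_holomorphic: "psum holomorphic_on {z. Re z > -1}"
  unfolding holomorphic_on_def
proof
  fix z assume "z \<in> {z. Re z > -1}"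
  then obtain c where c: "admissible c z" by (auto elim: ex_admissible)
  let ?S = "{z. c - 1 < Re z \<and> Re z < c}"
  have "psum holomorphic_on ?S"
  proof (rule holomorphic_transform)
    show "line_sum c holomorphic_on ?S"
      using c by (intro line_sum_holomorphic) (auto simp: admissible_def)
    show "line_sum c w = psum w" if "w \<in> ?S" for w
      using that c by (intro psum_eq_line_sum[symmetric]) (auto simp: admissible_def)
  qed
  then have "psum field_differentiable at z"
    using c open_vertical_strip
    by (intro holomorphic_on_imp_differentiable_at[of _ ?S]) (auto simp: admissible_def)
  then show "psum field_differentiable at z within {z. Re z > -1}"
    by (rule field_differentiable_at_within)
qed

lemma psum_of_nat: "psum (of_nat n) = (\<Sum>j=1..n. f (of_nat j))"
proof -
  obtain c where c: "admissible c (of_nat n)" by (rule ex_admissible[of "of_nat n"]) auto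
  have "psum (of_nat n) = (\<Sum>\<xi>\<in>int_translates 0 c 0. f \<xi>)"
    using psum_eq_line_sum[OF c] by (simp add: line_sum_def cot_kernel_Ints vertical_integral_def)
  also have "int_translates 0 c 0 = of_nat ` {1..n}"
    using c by (intro int_translates_0_eq_of_nat) (auto simp: admissible_def)
  finally show ?thesis by (simp add: sum.reindex)
qed

lemma psum_0: "psum 0 = 0"
  using psum_of_nat[of 0] by simp

lemma psum_step:
  assumes z: "Re z > 0"
  shows "psum z = psum (z - 1) + f z"
proof -
  have "max 0 (Re z - 1) < Re z" using z by simp
  then obtain c where c: "max 0 (Re z - 1) < c" "c < Re z" "c \<notin> \<int>" by (rule ex_not_Ints_between)
  have "c + 1 \<notin> \<int>" using Ints_diff[of "c + 1" 1] c(3) by auto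
  then have admissible: "admissible c (z - 1)" "admissible (c + 1) z"
    using c by (auto simp: admissible_def)
  have "c - Re z \<notin> \<int>" "c + 1 - Re z \<notin> \<int>"
    using c real_unit_interval_not_Ints[of "Re z - c"]
      real_unit_interval_not_Ints[of "c + 1 - Re z"]
      Ints_minus[of "c - Re z"] by auto
  then have "line_sum (c + 1) z - line_sum c z = (\<Sum>\<xi>\<in>int_translates c (c + 1) z. f \<xi>)"
    using c \<open>c + 1 \<notin> \<int>\<close> by (intro line_sum_diff) auto
  also have "int_translates c (c + 1) z = {z}"
    using c by (intro int_translates_unit_strip) auto
  finally have "line_sum (c + 1) z = line_sum c z + f z" by (simp add: diff_eq_eq add.commute)
  moreover have "line_sum c (z - 1) = line_sum c z"
    using cot_kernel_add_Ints[of "- 1" z] by (simp add: line_sum_def)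
  ultimately show ?thesis using admissible[THEN psum_eq_line_sum] by simp
qed

lemma norm_vertical_integral_f_cot_kernel_le:
  assumes "admissible c z" "0 < r" "r \<le> c - Re z" "c - Re z \<le> 1 - r"
  shows "norm (vertical_integral c (\<lambda>\<xi>. f \<xi> * cot_kernel z \<xi>))
    \<le> line_const c r * (LINT y|lborel. exp (- \<alpha> * \<bar>y\<bar>)) * exp (\<alpha> * \<bar>Im z\<bar>)"
proof -
  let ?h = "\<lambda>y. line_const c r * exp (\<alpha> * \<bar>Im z\<bar>) * exp (- \<alpha> * \<bar>- Im z + 1 * y\<bar>)"
  have shifted: "integrable lborel (\<lambda>y. exp (- \<alpha> * \<bar>- Im z + 1 * y\<bar>))"
    by (rule lborel_integrable_real_affine[OF integrable_exp_minus_abs[OF \<alpha>(1)]]) simp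
  have "norm (vertical_integral c (\<lambda>\<xi>. f \<xi> * cot_kernel z \<xi>)) \<le> (LINT y|lborel. ?h y)"
  proof (rule norm_vertical_integral_le)
    show "vertical_integrable c (\<lambda>\<xi>. f \<xi> * cot_kernel z \<xi>)"
      using assms(1) by (rule vertical_integrable_admissible)
    show "integrable lborel ?h" using shifted by (rule integrable_mult_right)
    show "norm (f (Complex c y) * cot_kernel z (Complex c y)) \<le> ?h y" for y
      using norm_f_cot_kernel_line_le[of c r z y] assms by (auto simp: admissible_def)
  qed
  also have "\<dots> = line_const c r * exp (\<alpha> * \<bar>Im z\<bar>) * (LINT y|lborel. exp (- \<alpha> * \<bar>- Im z + 1 * y\<bar>))"
    by (rule integral_mult_right_zero)
  also have "(LINT y|lborel. exp (- \<alpha> * \<bar>- Im z + 1 * y\<bar>)) = (LINT y|lborel. exp (- \<alpha> * \<bar>y\<bar>))"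
    using lborel_integral_real_affine[of 1 "\<lambda>y. exp (- \<alpha> * \<bar>y\<bar>)" "- Im z"] by simp
  finally show ?thesis by (simp add: mult_ac)
qed

lemma psum_bound_central_strip:
  obtains B where "B > 0" "\<And>z. - 1/2 \<le> Re z \<Longrightarrow> Re z \<le> 1/2 \<Longrightarrow> norm (psum z) \<le> B * exp (\<alpha> * \<bar>Im z\<bar>)"
proof -
  define I where "I = (LINT y|lborel. exp (- \<alpha> * \<bar>y\<bar>))"
  define A where "A = max (line_const (1/4) (1/4)) (line_const (3/4) (1/4))"
  have "0 \<le> I" unfolding I_def by (intro integral_nonneg_AE) auto
  have "0 \<le> A" using line_const_nonneg[of "1/4" "1/4"] by (auto simp: A_def le_max_iff_disj)
  have bound: "norm (psum z) \<le> (A * I + 1) * exp (\<alpha> * \<bar>Im z\<bar>)" if z: "- 1/2 \<le> Re z" "Re z \<le> 1/2"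
    for z
  proof -
    define c :: real where "c = (if Re z \<le> 0 then 1/4 else 3/4)"
    have c: "0 < c" "c < 1" "1/4 \<le> c - Re z" "c - Re z \<le> 1 - 1/4" using z by (auto simp: c_def)
    then have admissible: "admissible c z"
      using real_unit_interval_not_Ints[of c] by (auto simp: admissible_def)
    have "int_translates 0 c 0 = {}" using c int_translates_empty[of 0 0 c] by simp
    then have "norm (psum z) = 1/2 * norm (vertical_integral c (\<lambda>\<xi>. f \<xi> * cot_kernel z \<xi>))"
      by (simp add: psum_eq_line_sum[OF admissible] line_sum_def norm_mult norm_divide)
    also have "\<dots> \<le> 1 * (line_const c (1/4) * I * exp (\<alpha> * \<bar>Im z\<bar>))"
      using norm_vertical_integral_f_cot_kernel_le[OF admissible _ c(3,4)] unfolding I_def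
      by (intro mult_mono) auto
    also have "\<dots> \<le> (A * I + 1) * exp (\<alpha> * \<bar>Im z\<bar>)"
    proof -
      have "line_const c (1/4) * I \<le> A * I"
        using \<open>0 \<le> I\<close> by (intro mult_right_mono) (auto simp: A_def c_def)
      then show ?thesis unfolding mult_1 by (intro mult_right_mono) auto
    qed
    finally show ?thesis .
  qed
  show ?thesis
    using \<open>0 \<le> A\<close> \<open>0 \<le> I\<close> by (intro that[OF _ bound]) (simp_all add: add_nonneg_pos)
qed

lemma psum_bound_step:
  assumes \<kappa>: "1 \<le> \<kappa>" "\<rho> \<le> \<kappa>" and B: "2 * C \<le> B" and z: "Re z > 0"
    and prev: "norm (psum (z - 1)) \<le> B * exp (\<alpha> * \<bar>Im z\<bar> + \<kappa> * (Re z - 1))"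
  shows "norm (psum z) \<le> B * exp (\<alpha> * \<bar>Im z\<bar> + \<kappa> * Re z)"
proof -
  have "2 \<le> exp \<kappa>" using exp_ge_add_one_self[of \<kappa>] \<kappa> by linarith
  then have "exp (- \<kappa>) \<le> 1/2" by (simp add: exp_minus field_simps)
  have "norm (psum z) \<le> norm (psum (z - 1)) + norm (f z)"
    using psum_step[OF z] norm_triangle_ineq by simp
  also have "norm (psum (z - 1)) \<le> exp (- \<kappa>) * B * exp (\<alpha> * \<bar>Im z\<bar> + \<kappa> * Re z)"
    using prev by (simp add: right_diff_distrib exp_diff exp_add exp_minus field_simps)
  also have "\<dots> \<le> 1/2 * B * exp (\<alpha> * \<bar>Im z\<bar> + \<kappa> * Re z)"
    using \<open>exp (- \<kappa>) \<le> 1/2\<close> B C by (intro mult_right_mono) auto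
  also have "norm (f z) \<le> C * exp (\<alpha> * \<bar>Im z\<bar> + \<rho> * Re z)" using z by (rule f_bound)
  also have "\<dots> \<le> 1/2 * B * exp (\<alpha> * \<bar>Im z\<bar> + \<kappa> * Re z)"
    using B C \<kappa> z by (intro mult_mono) (auto intro: mult_right_mono)
  finally show ?thesis by simp
qed

lemma psum_bound:
  obtains B \<kappa> where "B > 0" "\<kappa> > 0"
    "\<And>z. - 1/2 \<le> Re z \<Longrightarrow> norm (psum z) \<le> B * exp (\<alpha> * \<bar>Im z\<bar> + \<kappa> * Re z)"
proof -
  obtain B0 where B0: "B0 > 0"
    "\<And>z. - 1/2 \<le> Re z \<Longrightarrow> Re z \<le> 1/2 \<Longrightarrow> norm (psum z) \<le> B0 * exp (\<alpha> * \<bar>Im z\<bar>)"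
    using psum_bound_central_strip by blast
  define \<kappa> where "\<kappa> = \<rho> + 1"
  have \<kappa>: "\<kappa> \<ge> 1" "\<kappa> \<ge> \<rho>" using \<rho> by (auto simp: \<kappa>_def)
  define B where "B = B0 * exp \<kappa> + 2 * C"
  have B: "B > 0" "B \<ge> B0 * exp \<kappa>" "B \<ge> 2 * C" using B0 C by (auto simp: B_def intro: add_pos_pos)
  have "norm (psum z) \<le> B * exp (\<alpha> * \<bar>Im z\<bar> + \<kappa> * Re z)"
    if "- 1/2 \<le> Re z" "Re z \<le> 1/2 + real n" for n z
    using that
  proof (induction n arbitrary: z)
    case 0
    have "norm (psum z) \<le> B0 * exp (\<alpha> * \<bar>Im z\<bar>)" using 0 B0(2)[of z] by simp
    also have "\<dots> = B0 * exp \<kappa> * exp (\<alpha> * \<bar>Im z\<bar> + \<kappa> * (-1))" by (simp flip: exp_add)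
    also have "\<dots> \<le> B * exp (\<alpha> * \<bar>Im z\<bar> + \<kappa> * Re z)"
    proof -
      have "\<kappa> * (-1) \<le> \<kappa> * Re z" using \<kappa> 0 by (intro mult_left_mono) auto
      then show ?thesis using B B0 by (intro mult_mono) auto
    qed
    finally show ?case .
  next
    case (Suc n)
    show ?case
    proof (cases "Re z \<le> 1/2 + real n")
      case True
      then show ?thesis using Suc by simp
    next
      case False
      then have "Re z > 1/2" by simp
      then show ?thesis using Suc.IH[of "z - 1"] Suc.prems \<kappa> B by (intro psum_bound_step) auto
    qed
  qed
  moreover have "Re z \<le> 1/2 + real (nat \<lceil>Re z\<rceil>)" for z :: complex by linarith
  ultimately show ?thesis using \<kappa> by (intro that[OF B(1), of \<kappa>]) auto
qed

section \<open>The indefinite sum\<close>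

text \<open>Since \<open>psum 0 = 0\<close>, the pole of \<open>Gamma\<close> at \<open>0\<close> is removable in \<open>Gamma s * psum s\<close>.\<close>

definition Gamma_psum :: "complex \<Rightarrow> complex" where
  "Gamma_psum s = Gamma (s + 1) * (if s = 0 then deriv psum 0 else psum s / s)"

lemma Gamma_psum_eq:
  assumes "s \<notin> \<int>\<^sub>\<le>\<^sub>0"
  shows "Gamma_psum s = Gamma s * psum s"
proof -
  have "s \<noteq> 0" using assms by auto
  then show ?thesis using Gamma_plus1[OF assms] by (simp add: Gamma_psum_def)
qed

lemma Gamma_psum_holomorphic: "Gamma_psum holomorphic_on {s. Re s > -1}"
proof -
  have "(\<lambda>s. if s = 0 then deriv psum 0 else psum s / s) holomorphic_on {s. Re s > -1}"
    using pole_lemma_open[OF psum_holomorphic open_halfspace_Re_gt, of 0]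
    unfolding psum_0 diff_zero .
  moreover have "(\<lambda>s. Gamma (s + 1)) holomorphic_on {s. Re s > -1}"
    by (intro holomorphic_intros Re_pos_not_nonpos_Ints) auto
  ultimately show ?thesis unfolding Gamma_psum_def by (intro holomorphic_on_mult)
qed

lemma strip_growth_psum:
  assumes "- 1/2 \<le> a"
  shows "strip_growth a b \<alpha> psum"
proof -
  obtain B \<kappa> where "B > 0" "\<kappa> > 0"
    and bound: "\<And>z. - 1/2 \<le> Re z \<Longrightarrow> norm (psum z) \<le> B * exp (\<alpha> * \<bar>Im z\<bar> + \<kappa> * Re z)"
    using psum_bound by blast
  then show ?thesis
    using assms by (intro strip_growth_exp_bound[where B = B and \<kappa> = \<kappa> and Y = 0]) auto
qed

lemma strip_growth_f:
  assumes "0 < a"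
  shows "strip_growth a b \<alpha> f"
  using assms C f_bound by (intro strip_growth_exp_bound[where B = C and \<kappa> = \<rho> and Y = 0]) auto

lemma decays_on_strip_Gamma_psum: "decays_on_strip (- 1/2) u Gamma_psum"
  unfolding decays_on_strip_def
proof (intro conjI allI impI)
  show "Gamma_psum holomorphic_on {s. - 1/2 < Re s \<and> Re s < u}"
    by (rule holomorphic_on_subset[OF Gamma_psum_holomorphic]) auto
  fix a b :: real assume "- 1/2 < a"
  then have "strip_growth a b ((\<alpha> - pi / 2) / 2) (\<lambda>s. Gamma s * psum s)"
    using \<alpha>(2) by (intro strip_growth_Gamma_mult strip_growth_psum) auto
  then have "strip_growth a b ((\<alpha> - pi / 2) / 2) Gamma_psum"
    by (rule strip_growth_cong) (metis Gamma_psum_eq nonpos_Ints_Im_eq_0)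
  then show "\<exists>\<beta><0. strip_growth a b \<beta> Gamma_psum"
    using \<alpha>(2) by (intro exI[of _ "(\<alpha> - pi / 2) / 2"]) auto
qed

lemma decays_on_strip_Gamma_f: "decays_on_strip 0 u (\<lambda>s. Gamma s * f s)"
  unfolding decays_on_strip_def
proof (intro conjI allI impI)
  show "(\<lambda>s. Gamma s * f s) holomorphic_on {s. 0 < Re s \<and> Re s < u}"
    by (intro holomorphic_intros holomorphic_on_subset[OF f_holomorphic])
       (auto dest: Re_pos_not_nonpos_Ints)
  fix a b :: real assume "0 < a"
  then show "\<exists>\<beta><0. strip_growth a b \<beta> (\<lambda>s. Gamma s * f s)"
    using \<alpha>(2) by (intro exI[of _ "(\<alpha> - pi / 2) / 2"] conjI strip_growth_Gamma_mult strip_growth_f)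
      auto
qed

lemma Gamma_f_eq_Gamma_psum_diff:
  assumes "0 < Re s" "Re s < 1"
  shows "Gamma s * f s = Gamma_psum s - (s - 1) * Gamma_psum (s - 1)"
proof -
  have not_pole: "s \<notin> \<int>\<^sub>\<le>\<^sub>0" "s - 1 \<notin> \<int>\<^sub>\<le>\<^sub>0"
    using assms Re_Ints[of "s - 1"] real_unit_interval_not_Ints[of "Re s"] Ints_add[of "Re s - 1" 1]
      nonpos_Ints_Int[of s] nonpos_Ints_Int[of "s - 1"] Re_Ints[of s] by auto
  have "(s - 1) * Gamma_psum (s - 1) = Gamma s * psum (s - 1)"
    using Gamma_plus1[OF not_pole(2)] by (simp add: Gamma_psum_eq[OF not_pole(2)])
  then show ?thesis
    using psum_step[OF assms(1)] by (simp add: Gamma_psum_eq[OF not_pole(1)] algebra_simps)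
qed

lemma inverse_mellin_Gamma_f:
  assumes "\<sigma> > 0" "x > 0"
  shows "inverse_mellin \<sigma> (\<lambda>s. Gamma s * f s) x =
    inverse_mellin (- 1/4) Gamma_psum x
      - inverse_mellin (- 1/4) (\<lambda>s. s * Gamma_psum s) x / of_real x"
proof -
  let ?D = "\<lambda>s. s * Gamma_psum s"
  have D_integrable: "vertical_integrable (- 1/4 + 1) (\<lambda>s. ?D (s - 1))"
    by (intro vertical_integrable_shift_argument
        vertical_integrable_decays_on_strip[OF
            decays_on_strip_ident_mult[OF decays_on_strip_Gamma_psum[of 1]]]) auto
  have psum_integrable: "vertical_integrable (- 1/4 + 1) Gamma_psum"
    by (rule vertical_integrable_decays_on_strip[OF decays_on_strip_Gamma_psum[of 1]]) auto
  have "inverse_mellin \<sigma> (\<lambda>s. Gamma s * f s) x = inverse_mellin (- 1/4 + 1) (\<lambda>s. Gamma s * f s) x"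
    using assms by (intro inverse_mellin_line_independent[OF decays_on_strip_Gamma_f[of "\<sigma> + 1"]])
      auto
  also have "\<dots> = inverse_mellin (- 1/4 + 1) (\<lambda>s. Gamma_psum s - ?D (s - 1)) x"
    by (intro inverse_mellin_cong Gamma_f_eq_Gamma_psum_diff) auto
  also have "\<dots> = inverse_mellin (- 1/4 + 1) Gamma_psum x
      - inverse_mellin (- 1/4 + 1) (\<lambda>s. ?D (s - 1)) x"
    using psum_integrable D_integrable assms(2) by (rule inverse_mellin_diff)
  also have "inverse_mellin (- 1/4 + 1) Gamma_psum x = inverse_mellin (- 1/4) Gamma_psum x"
    using assms by (intro inverse_mellin_line_independent[OF decays_on_strip_Gamma_psum[of 1]]) auto
  also have "inverse_mellin (- 1/4 + 1) (\<lambda>s. ?D (s - 1)) x =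
      inverse_mellin (- 1/4) ?D x / of_real x"
    using assms(2) by (rule inverse_mellin_shift_argument)
  finally show ?thesis .
qed

lemma indef_sum_inner_eq_inverse_mellin:
  "indef_sum_inner \<sigma> f x = of_real (exp x) * inverse_mellin \<sigma> (\<lambda>s. Gamma s * f s) x"
  by (simp add: indef_sum_inner_def inverse_mellin_def indef_sum_kernel_def[abs_def])

lemma indef_sum_inner_integral:
  assumes "\<sigma> > 0" "t > 0"
  shows "set_integrable lborel {0<..<t} (indef_sum_inner \<sigma> f)"
    "(LINT x:{0<..<t}|lborel. indef_sum_inner \<sigma> f x) =
        of_real (exp t) * inverse_mellin (- 1/4) Gamma_psum t"
proof -
  let ?w = "\<lambda>x. of_real (exp x) *
    (inverse_mellin (- 1/4) Gamma_psum x
      - inverse_mellin (- 1/4) (\<lambda>s. s * Gamma_psum s) x / of_real x)"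
  have inner: "indef_sum_inner \<sigma> f x = ?w x" if "x \<in> {0<..<t}" for x
    using that assms(1) by (simp add: indef_sum_inner_eq_inverse_mellin inverse_mellin_Gamma_f)
  have G: "vertical_integrable (- 1/4) Gamma_psum"
    "vertical_integrable (- 1/4) (\<lambda>s. s * Gamma_psum s)"
    by (rule vertical_integrable_decays_on_strip[OF decays_on_strip_Gamma_psum[of 1]]
      vertical_integrable_decays_on_strip[OF
          decays_on_strip_ident_mult[OF decays_on_strip_Gamma_psum[of 1]]]; simp)+
  have "- 1/4 < (0 :: real)" by simp
  note FTC = set_integral_exp_inverse_mellin[OF this assms(2) G]
  have "set_integrable lborel {0<..<t} (indef_sum_inner \<sigma> f) \<longleftrightarrow> set_integrable lborel {0<..<t} ?w"
    using inner by (intro set_integrable_cong refl)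
  then show "set_integrable lborel {0<..<t} (indef_sum_inner \<sigma> f)" using FTC(1) by blast
  have "(LINT x:{0<..<t}|lborel. indef_sum_inner \<sigma> f x) = (LINT x:{0<..<t}|lborel. ?w x)"
    using inner by (intro set_lebesgue_integral_cong) auto
  then show "(LINT x:{0<..<t}|lborel. indef_sum_inner \<sigma> f x) =
      of_real (exp t) * inverse_mellin (- 1/4) Gamma_psum t"
    using FTC(2) by (rule trans)
qed

lemma indef_sum_outer_eq:
  assumes "\<sigma> > 0" "t > 0"
  shows "indef_sum_outer \<sigma> f z t = of_real t powr (z - 1) * inverse_mellin (- 1/4) Gamma_psum t"
proof -
  have "of_real (exp (- t)) * of_real (exp t) = (1 :: complex)"
    by (simp flip: of_real_mult exp_add)
  then show ?thesis
    unfolding indef_sum_outer_def indef_sum_inner_integral(2)[OF assms]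
    by (simp add: mult.assoc[symmetric])
qed

lemma indef_sum_converges_and_eq_psum:
  assumes \<sigma>: "\<sigma> > 0" and z: "Re z > 0"
  shows "indef_sum_converges \<sigma> f z" "indef_sum \<sigma> f z = psum z"
proof -
  have "- 1/2 < (- 1/4 :: real)" "- 1/4 < Re z + 1" "- 1/2 < Re z" "Re z < Re z + 1" using z by auto
  note inversion = mellin_inversion[OF decays_on_strip_Gamma_psum this]
  have "vertical_integrable \<sigma> (indef_sum_kernel f x)" if "x > 0" for x
    unfolding indef_sum_kernel_def[abs_def]
    using \<sigma> that by (intro vertical_integrable_mult_of_real_powr
        vertical_integrable_decays_on_strip[OF decays_on_strip_Gamma_f[of "\<sigma> + 1"]]) auto
  moreover have "set_integrable lborel {0<..} (indef_sum_outer \<sigma> f z) \<longleftrightarrow>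
      set_integrable lborel {0<..}
        (\<lambda>t. of_real t powr (z - 1) * inverse_mellin (- 1/4) Gamma_psum t)"
    using \<sigma> by (intro set_integrable_cong refl) (simp add: indef_sum_outer_eq)
  ultimately show "indef_sum_converges \<sigma> f z"
    using indef_sum_inner_integral(1)[OF \<sigma>] inversion(1) by (simp add: indef_sum_converges_def)
  have "(LINT t:{0<..}|lborel. indef_sum_outer \<sigma> f z t) =
      (LINT t:{0<..}|lborel. of_real t powr (z - 1) * inverse_mellin (- 1/4) Gamma_psum t)"
    using \<sigma> by (intro set_lebesgue_integral_cong) (auto simp: indef_sum_outer_eq)
  also have "\<dots> = Gamma z * psum z"
    using inversion(2) Gamma_psum_eq[OF Re_pos_not_nonpos_Ints[OF z]] by simp
  finally show "indef_sum \<sigma> f z = psum z"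
    using Re_pos_not_nonpos_Ints[OF z] by (simp add: indef_sum_def Gamma_eq_zero_iff)
qed

section \<open>The series and the exponential generating function\<close>

lemma sum_f_eq_psum: "(\<Sum>j=1..n+1. f (of_nat j)) = psum (of_nat n + 1)"
  using psum_of_nat[of "n + 1"] by (simp add: add.commute)

lemma summable_vartheta_term: "summable (vartheta_term f x)"
proof -
  obtain B \<kappa> where B: "B > 0" "\<kappa> > 0"
    "\<And>z. - 1/2 \<le> Re z \<Longrightarrow> norm (psum z) \<le> B * exp (\<alpha> * \<bar>Im z\<bar> + \<kappa> * Re z)"
    using psum_bound by blast
  show ?thesis
  proof (rule summable_comparison_test'[of _ 0])
    show "summable (\<lambda>n. B * exp \<kappa> * (inverse (fact n) * (exp \<kappa> * norm x) ^ n))"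
      by (intro summable_mult summable_exp)
    fix n
    have "norm (vartheta_term f x n) = norm (psum (of_nat n + 1)) * (norm x ^ n / fact n)"
      unfolding vartheta_term_def sum_f_eq_psum by (simp add: norm_mult norm_divide norm_power)
    also have "\<dots> \<le> (B * exp (real n * \<kappa> + \<kappa>)) * (norm x ^ n / fact n)"
      using B(3)[of "of_nat n + 1"] by (intro mult_right_mono) (auto simp: algebra_simps)
    also have "\<dots> = B * exp \<kappa> * (inverse (fact n) * (exp \<kappa> * norm x) ^ n)"
      unfolding exp_add exp_of_nat_mult power_mult_distrib by (simp add: field_simps)
    finally show "norm (vartheta_term f x n) \<le>
        B * exp \<kappa> * (inverse (fact n) * (exp \<kappa> * norm x) ^ n)" .
  qed
qed

lemma vartheta_holomorphic: "vartheta f holomorphic_on UNIV"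
proof -
  have "vartheta f holomorphic_on ball 0 r" for r
  proof (rule power_series_holomorphic[where a = "\<lambda>n. (\<Sum>j=1..n+1. f (of_nat j)) / fact n"])
    fix w
    have "vartheta_term f w sums vartheta f w"
      unfolding vartheta_def using summable_vartheta_term by (rule summable_sums)
    then show "(\<lambda>n. (\<Sum>j=1..n+1. f (of_nat j)) / fact n * (w - 0) ^ n) sums vartheta f w"
      by (simp add: vartheta_term_def[abs_def])
  qed
  then have "vartheta f field_differentiable at z" for z
    by (intro holomorphic_on_imp_differentiable_at[of _ "ball 0 (norm z + 1)"]) auto
  then show ?thesis by (simp add: holomorphic_on_def)
qed

lemma psum_reflect_bound:
  obtains B \<kappa> where "B \<ge> 0" "\<And>s. Re s \<le> 3/2 \<Longrightarrow> norm (psum (1 - s)) \<le> B * exp (\<alpha> * \<bar>Im s\<bar> - \<kappa> * Re s)"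
proof -
  obtain B \<kappa> where B: "B > 0" "\<kappa> > 0"
    "\<And>z. - 1/2 \<le> Re z \<Longrightarrow> norm (psum z) \<le> B * exp (\<alpha> * \<bar>Im z\<bar> + \<kappa> * Re z)"
    using psum_bound by blast
  show ?thesis
  proof (rule that[of "B * exp \<kappa>" \<kappa>])
    fix s assume "Re s \<le> 3/2"
    then have "norm (psum (1 - s)) \<le> B * exp (\<alpha> * \<bar>Im s\<bar> + \<kappa> * (1 - Re s))"
      using B(3)[of "1 - s"] by simp
    also have "\<dots> = B * exp \<kappa> * exp (\<alpha> * \<bar>Im s\<bar> - \<kappa> * Re s)"
      by (simp add: algebra_simps flip: exp_add)
    finally show "norm (psum (1 - s)) \<le> B * exp \<kappa> * exp (\<alpha> * \<bar>Im s\<bar> - \<kappa> * Re s)" .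
  qed (use B in auto)
qed

lemma psum_reflect_holomorphic: "(\<lambda>s. psum (1 - s)) holomorphic_on {s. Re s < 2}"
proof -
  have "(psum \<circ> (\<lambda>s. 1 - s)) holomorphic_on {s. Re s < 2}"
    by (intro holomorphic_on_compose_gen[OF _ psum_holomorphic] holomorphic_intros) auto
  then show ?thesis by (simp add: o_def)
qed

lemma vertical_integrable_Gamma_psum_reflect: "vertical_integrable 1 (\<lambda>s. Gamma s * psum (1 - s))"
proof -
  obtain B \<kappa> where B: "B \<ge> 0"
    "\<And>s. Re s \<le> 3/2 \<Longrightarrow> norm (psum (1 - s)) \<le> B * exp (\<alpha> * \<bar>Im s\<bar> - \<kappa> * Re s)"
    using psum_reflect_bound by blast
  show ?thesis
    by (rule Gamma_residue_sums(1)[where P = "{}" and b = 2 and \<alpha> = \<alpha> and \<kappa> = \<kappa> and B = B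
          and R = 0])
       (use B \<alpha>(2) psum_reflect_holomorphic in auto)
qed

lemma vartheta_eq_inverse_mellin:
  assumes "x > 0"
  shows "vartheta f (- of_real x) = inverse_mellin 1 (\<lambda>s. Gamma s * psum (1 - s)) x"
proof -
  let ?W = "\<lambda>s. psum (1 - s) * of_real x powr (- s)"
  obtain B \<kappa> where B: "B \<ge> 0"
    "\<And>s. Re s \<le> 3/2 \<Longrightarrow> norm (psum (1 - s)) \<le> B * exp (\<alpha> * \<bar>Im s\<bar> - \<kappa> * Re s)"
    using psum_reflect_bound by blast
  have "(\<lambda>n. (-1) ^ n / fact n * ?W (- of_nat n)) sums
      (1 / (2 * of_real pi * \<i>) * vertical_integral 1 (\<lambda>s. Gamma s * ?W s) -
          (\<Sum>p\<in>{}. residue (\<lambda>s. Gamma s * ?W s) p))"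
  proof (rule Gamma_residue_sums(2)[where b = 2 and \<alpha> = \<alpha> and \<kappa> = "\<kappa> + ln x" and B = B and R = 0])
    show "?W holomorphic_on {s. Re s < 2} - {}"
      using psum_reflect_holomorphic assms by (auto intro!: holomorphic_intros)
    fix s :: complex assume "Re s \<le> 1"
    then have "norm (?W s) \<le> B * exp (\<alpha> * \<bar>Im s\<bar> - \<kappa> * Re s) * exp (- Re s * ln x)"
      unfolding norm_mult using B assms
      by (intro mult_mono) (auto simp: norm_powr_real_powr powr_def)
    also have "\<dots> = B * exp (\<alpha> * \<bar>Im s\<bar> - (\<kappa> + ln x) * Re s)"
      by (simp add: algebra_simps flip: exp_add)
    finally show "norm (?W s) \<le> B * exp (\<alpha> * \<bar>Im s\<bar> - (\<kappa> + ln x) * Re s)" .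
  qed (use B(1) \<alpha>(2) in auto)
  moreover have "(-1) ^ n / fact n * ?W (- of_nat n) = vartheta_term f (- of_real x) n" for n
  proof -
    have "(of_real x :: complex) powr of_nat n = of_real x ^ n"
      using assms by (simp add: powr_nat')
    then show ?thesis
      unfolding vartheta_term_def sum_f_eq_psum power_minus[of "of_real x"]
      by (simp add: add.commute)
  qed
  ultimately show ?thesis
    unfolding vartheta_def inverse_mellin_def by (simp add: sums_iff mult.assoc)
qed

lemma rhs_integrand_integral:
  assumes z: "Re z > 0"
  shows "set_integrable lborel {1..} (rhs_integrand f z)"
    "(LINT x:{1..}|lborel. rhs_integrand f z x) =
      1 / (2 * of_real pi * \<i>) * vertical_integral 1 (\<lambda>s. Gamma s * psum (1 - s) / (s - (1 - z)))"
proof -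
  let ?h = "\<lambda>t. of_real t powr (1 - z - 1) * inverse_mellin 1 (\<lambda>s. Gamma s * psum (1 - s)) t"
  have "Re (1 - z) < 1" using z by simp
  note mellin =
    set_integral_powr_inverse_mellin_ge_1[OF vertical_integrable_Gamma_psum_reflect this]
  have integrand: "rhs_integrand f z t = ?h t" if "t \<in> {1..}" for t
    using that by (simp add: rhs_integrand_def vartheta_eq_inverse_mellin)
  have "set_integrable lborel {1..} (rhs_integrand f z) \<longleftrightarrow> set_integrable lborel {1..} ?h"
    using integrand by (intro set_integrable_cong refl)
  then show "set_integrable lborel {1..} (rhs_integrand f z)" using mellin(1) by blast
  have "(LINT x:{1..}|lborel. rhs_integrand f z x) = (LINT x:{1..}|lborel. ?h x)"
    using integrand by (intro set_lebesgue_integral_cong) auto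
  then show "(LINT x:{1..}|lborel. rhs_integrand f z x) =
      1 / (2 * of_real pi * \<i>) * vertical_integral 1 (\<lambda>s. Gamma s * psum (1 - s) / (s - (1 - z)))"
    using mellin(2) by (rule trans)
qed

lemma residue_Gamma_psum_reflect:
  assumes z: "Re z > 0" "1 - z \<notin> \<int>\<^sub>\<le>\<^sub>0"
  shows "residue (\<lambda>s. Gamma s * (psum (1 - s) / (s - (1 - z)))) (1 - z) = Gamma (1 - z) * psum z"
proof -
  have "residue (\<lambda>s. Gamma s * psum (1 - s) / (s - (1 - z))) (1 - z) =
      Gamma (1 - z) * psum (1 - (1 - z))"
  proof (rule residue_simple)
    show "open ({s. Re s < 2} - \<int>\<^sub>\<le>\<^sub>0)" by (intro open_Diff open_halfspace_Re_lt closed_nonpos_Ints)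
    show "(\<lambda>s. Gamma s * psum (1 - s)) holomorphic_on {s. Re s < 2} - \<int>\<^sub>\<le>\<^sub>0"
      by (intro holomorphic_intros holomorphic_on_subset[OF psum_reflect_holomorphic]) auto
  qed (use z in auto)
  then show ?thesis by simp
qed

lemma rhs_term_sums:
  assumes z: "Re z > 0" "1 - z \<notin> \<int>\<^sub>\<le>\<^sub>0"
  shows "rhs_term f z sums (Gamma (1 - z) * psum z -
    1 / (2 * of_real pi * \<i>) * vertical_integral 1 (\<lambda>s. Gamma s * psum (1 - s) / (s - (1 - z))))"
proof -
  define W where "W s = psum (1 - s) / (s - (1 - z))" for s
  obtain B \<kappa> where B: "B \<ge> 0"
    "\<And>s. Re s \<le> 3/2 \<Longrightarrow> norm (psum (1 - s)) \<le> B * exp (\<alpha> * \<bar>Im s\<bar> - \<kappa> * Re s)"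
    using psum_reflect_bound by blast
  have "(\<lambda>n. (-1) ^ n / fact n * W (- of_nat n)) sums
      (1 / (2 * of_real pi * \<i>) * vertical_integral 1 (\<lambda>s. Gamma s * W s)
        - (\<Sum>p\<in>{1 - z}. residue (\<lambda>s. Gamma s * W s) p))"
  proof (rule Gamma_residue_sums(2)[where b = 2 and \<alpha> = \<alpha> and \<kappa> = \<kappa> and B = B
        and R = "norm (1 - z) + 1"])
    show "W holomorphic_on {s. Re s < 2} - {1 - z}"
      unfolding W_def
      by (intro holomorphic_on_divide holomorphic_on_subset[OF psum_reflect_holomorphic]
          holomorphic_intros) auto
    fix s assume s: "Re s \<le> 1" "norm (1 - z) + 1 \<le> norm s"
    have "1 \<le> norm (s - (1 - z))" using norm_triangle_ineq2[of s "1 - z"] s(2) by linarith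
    then have "norm (W s) \<le> norm (psum (1 - s)) / 1"
      unfolding W_def norm_divide by (intro divide_left_mono) auto
    then show "norm (W s) \<le> B * exp (\<alpha> * \<bar>Im s\<bar> - \<kappa> * Re s)" using B(2)[of s] s(1) by simp
  qed (use B(1) \<alpha>(2) z in auto)
  from sums_minus[OF this] have "(\<lambda>n. - ((-1) ^ n / fact n * W (- of_nat n))) sums
      (Gamma (1 - z) * psum z - 1 / (2 * of_real pi * \<i>) * vertical_integral 1 (\<lambda>s. Gamma s * W s))"
    using residue_Gamma_psum_reflect[OF z] by (simp add: W_def)
  moreover have "- ((-1) ^ n / fact n * W (- of_nat n)) = rhs_term f z n" for n
  proof -
    have "W (- of_nat n) = - (psum (of_nat n + 1) / (of_nat n + 1 - z))"
      unfolding minus_divide_right by (simp add: W_def algebra_simps)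
    then show ?thesis unfolding rhs_term_def sum_f_eq_psum by simp
  qed
  ultimately show ?thesis by (simp add: W_def)
qed

lemma rhs_converges_and_eq_psum:
  assumes z: "Re z > 0" "z \<notin> \<nat>"
  shows "summable (rhs_term f z)" "rhs f z = psum z"
proof -
  have not_pole: "1 - z \<notin> \<int>\<^sub>\<le>\<^sub>0"
  proof
    assume "1 - z \<in> \<int>\<^sub>\<le>\<^sub>0"
    then obtain n where "1 - z = - of_nat n" by (elim nonpos_Ints_cases')
    then have "z = of_nat (n + 1)" by (simp add: algebra_simps)
    then show False using z(2) by (metis of_nat_in_Nats)
  qed
  note sums = rhs_term_sums[OF z(1) not_pole]
  show "summable (rhs_term f z)" using sums by (rule sums_summable)
  show "rhs f z = psum z"
    unfolding rhs_def sums_unique[OF sums, symmetric] rhs_integrand_integral(2)[OF z(1)]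
    using not_pole by (simp add: Gamma_eq_zero_iff)
qed

lemma rhs_tendsto_psum:
  assumes "Re z > 0"
  shows "(rhs f \<longlongrightarrow> psum z) (at z)"
proof (rule Lim_transform_eventually)
  have "isCont psum z"
    using holomorphic_on_imp_continuous_on[OF psum_holomorphic] assms
    by (simp add: continuous_on_eq_continuous_at open_halfspace_Re_gt)
  then show "(psum \<longlongrightarrow> psum z) (at z)" by (simp add: isCont_def)
  have "open ({w. Re w > 0} - (\<nat> - {z}))"
    by (intro open_Diff open_halfspace_Re_gt closed_subset_Ints)
      (auto intro: Nats_subset_Ints[THEN subsetD])
  then have "\<forall>\<^sub>F w in at z. w \<in> {w. Re w > 0} - (\<nat> - {z}) \<and> w \<noteq> z"
    using assms by (auto simp: eventually_at_topological)
  then show "\<forall>\<^sub>F w in at z. psum w = rhs f w"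
    by eventually_elim (auto simp: rhs_converges_and_eq_psum(2))
qed

end

lemma space_E_imp_exp_type:
  assumes "f \<in> space_E"
  obtains \<alpha> \<rho> C where "exp_type f \<alpha> \<rho> C"
proof -
  obtain \<alpha> \<rho> C where f: "f holomorphic_on {z. Re z > 0}" "0 \<le> \<alpha>" "\<alpha> < pi / 2" "0 \<le> \<rho>" "0 < C"
    and bound: "\<And>z. Re z > 0 \<Longrightarrow> norm (f z) < C * exp (\<alpha> * \<bar>Im z\<bar> + \<rho> * \<bar>Re z\<bar>)"
    using assms unfolding space_E_def by blast
  have "exp_type f (max \<alpha> (pi / 4)) \<rho> C"
  proof
    fix z :: complex assume z: "Re z > 0"
    have "norm (f z) \<le> C * exp (\<alpha> * \<bar>Im z\<bar> + \<rho> * \<bar>Re z\<bar>)" using bound[OF z] by simp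
    also have "\<dots> \<le> C * exp (max \<alpha> (pi / 4) * \<bar>Im z\<bar> + \<rho> * Re z)"
      using f z by (intro mult_left_mono) (auto intro: mult_right_mono)
    finally show "norm (f z) \<le> C * exp (max \<alpha> (pi / 4) * \<bar>Im z\<bar> + \<rho> * Re z)" .
  qed (use f in auto)
  then show ?thesis by (rule that)
qed

theorem corollary3p1:
  fixes f :: "complex \<Rightarrow> complex" and \<sigma> :: real and z :: complex
  assumes "f \<in> space_E" and "\<sigma> > 0" and "Re z > 0"
  shows "(\<forall>x. summable (vartheta_term f x)) \<and> vartheta f holomorphic_on UNIV \<and>
         indef_sum_converges \<sigma> f z \<and>
         (z \<notin> \<nat> \<longrightarrow>
            summable (rhs_term f z) \<and> set_integrable lborel {1..} (rhs_integrand f z) \<and>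
            indef_sum \<sigma> f z = rhs f z) \<and>
         (z \<in> \<nat> \<longrightarrow> (rhs f \<longlongrightarrow> indef_sum \<sigma> f z) (at z))"
proof -
  obtain \<alpha> \<rho> C where "exp_type f \<alpha> \<rho> C"
    using assms(1) by (rule space_E_imp_exp_type)
  then interpret exp_type f \<alpha> \<rho> C .
  have "indef_sum \<sigma> f z = psum z" "indef_sum_converges \<sigma> f z"
    using assms(2,3) by (simp_all add: indef_sum_converges_and_eq_psum)
  moreover have "summable (rhs_term f z) \<and> rhs f z = psum z" if "z \<notin> \<nat>"
    using rhs_converges_and_eq_psum[OF assms(3) that] by simp
  ultimately show ?thesis
    using summable_vartheta_term vartheta_holomorphic rhs_integrand_integral(1)[OF assms(3)]
      rhs_tendsto_psum[OF assms(3)] by simp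
qed

end
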